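(* Let $\sigma,\delta\in\mathbb{N}\setminus\{0\}$ with $\delta\in(0,\sigma)$, and let $p,q>1$. Assume that the initial data $\big((u_0,u_1),(v_0,v_1)\big)\in\mathcal{A}^{\mathtt{k}^+}_1\times\mathcal{A}^{\mathtt{k}^+}_1$ satisfy $$\liminf_{R\to\infty}\int_{B_R}\big(u_1(x)+(-\Delta)^\delta u_0(x)\big)dx>0,\qquad \liminf_{R\to\infty}\int_{B_R}\big(v_1(x)+(-\Delta)^\delta v_0(x)\big)dx>0, \qquad ( * )$$ where $B_R:=\{x\in\mathbb{R}^n:|x|\le R\}$. Moreover, suppose $$n\le\mathtt{k}^-+\frac{2\sigma(1+\max\{p,q\})}{pq-1}.$$ Then there is no global (in time) energy solution to $$\begin{cases}u_{tt}+(-\Delta)^\sigma u+(-\Delta)^\delta u_t=|v|^p,\quad v_{tt}+(-\Delta)^\sigma v+(-\Delta)^\delta v_t=|u|^q,\\ u(0,x)=u_0(x),\ u_t(0,x)=u_1(x),\ v(0,x)=v_0(x),\ v_t(0,x)=v_1(x),\end{cases}$$ and the blow-up time $T_\varepsilon$ is estimated by $$T_\varepsilon\le C\,\varepsilon^{-\frac{2\sigma-\mathtt{k}^-}{\mathtt{k}^-+\frac{2\sigma(q+1)}{pq}-n}}$$ with $C>0$ and a small constant $\varepsilon$.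
   Context: Notation: $n\ge1$ is the space dimension, $\mathtt{k}^-:=\min\{\sigma,2\delta\}$, $\mathtt{k}^+:=\max\{\sigma,2\delta\}$, and $\mathcal{A}^{\mathtt{k}^+}_1:=(L^1\cap H^{\mathtt{k}^+})\times(L^1\cap L^2)$ (functions on $\mathbb{R}^n$; $H^a$ is the Bessel potential space based on $L^2$). Weak solution: for $T>0$, $(u,v)\in L^q_{loc}([0,T)\times\mathbb{R}^n)\times L^p_{loc}([0,T)\times\mathbb{R}^n)$ is a weak solution of the system if for every test function $\phi\in C_0^\infty([0,T)\times\mathbb{R}^n)$ $$\int_0^T\!\!\int_{\mathbb{R}^n}|v|^p\phi\,dxdt+\int_{\mathbb{R}^n}\big(u_1+(-\Delta)^\delta u_0\big)\phi(0,x)dx=\int_{\mathbb{R}^n}u_0\phi_t(0,x)dx+\int_0^T\!\!\int_{\mathbb{R}^n}u\big(\phi_{tt}-(-\Delta)^\delta\phi_t+(-\Delta)^\sigma\phi\big)dxdt$$ and $$\int_0^T\!\!\int_{\mathbb{R}^n}|u|^q\phi\,dxdt+\int_{\mathbb{R}^n}\big(v_1+(-\Delta)^\delta v_0\big)\phi(0,x)dx=\int_{\mathbb{R}^n}v_0\phi_t(0,x)dx+\int_0^T\!\!\int_{\mathbb{R}^n}v\big(\phi_{tt}-(-\Delta)^\delta\phi_t+(-\Delta)^\sigma\phi\big)dxdt.$$ It is global if $T=\infty$. Energy solutions are those with $(u,v)\in\big(C([0,T),H^{\mathtt{k}^+})\cap C^1([0,T),L^2)\big)^2$. Meaning of $T_\varepsilon$: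 for the blow-up time estimate the initial data are replaced by $\big((\varepsilon f_0,\varepsilon f_1),(\varepsilon g_0,\varepsilon g_1)\big)$ with a small constant $\varepsilon>0$, where $\big((f_0,f_1),(g_0,g_1)\big)\in\mathcal{A}^{\mathtt{k}^+}_1\times\mathcal{A}^{\mathtt{k}^+}_1$ satisfies $( * )$ (with $f_j,g_j$ in place of $u_j,v_j$); $T_\varepsilon$ is the blow-up time of the corresponding local solution.
   Formalization: The blow-up time estimate is stated only when k^- + 2σ(q+1)/(pq) − n > 0; under the hypotheses this denominator can be zero (exponent undefined) or negative (the printed bound is then false, e.g. σ=2, δ=1, n=3, p=q=4.9). *)

theory Defs
  imports "HOL-Analysis.Analysis"
begin

section \<open>Test functions and differential operators\<close>

primrec C_k :: "nat \<Rightarrow> ('a::euclidean_space \<Rightarrow> real) \<Rightarrow> bool" where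
  "C_k 0 f \<longleftrightarrow> continuous_on UNIV f"
| "C_k (Suc k) f \<longleftrightarrow> f differentiable_on UNIV \<and>
     (\<forall>b\<in>Basis. C_k k (\<lambda>x. frechet_derivative f (at x) b))"

definition smooth :: "('a::euclidean_space \<Rightarrow> real) \<Rightarrow> bool" where
  "smooth f \<longleftrightarrow> (\<forall>k. C_k k f)"

definition test_functions :: "'a::euclidean_space set \<Rightarrow> ('a \<Rightarrow> real) set" where
  "test_functions U = {\<phi>. smooth \<phi> \<and> compact (closure {x. \<phi> x \<noteq> 0}) \<and> closure {x. \<phi> x \<noteq> 0} \<subseteq> U}"

definition partial_deriv :: "'a::euclidean_space \<Rightarrow> ('a \<Rightarrow> real) \<Rightarrow> 'a \<Rightarrow> real" where
  "partial_deriv b f x = deriv (\<lambda>s. f (x + s *\<^sub>R b)) 0"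

definition neg_laplacian :: "('a::euclidean_space \<Rightarrow> real) \<Rightarrow> 'a \<Rightarrow> real" where
  "neg_laplacian f x = - (\<Sum>b\<in>Basis. partial_deriv b (partial_deriv b f) x)"

definition time_deriv :: "(real \<times> 'a::euclidean_space \<Rightarrow> real) \<Rightarrow> real \<times> 'a \<Rightarrow> real" where
  "time_deriv \<phi> = (\<lambda>(t, x). deriv (\<lambda>s. \<phi> (s, x)) t)"

definition space_neg_laplacian_pow ::
    "nat \<Rightarrow> (real \<times> 'a::euclidean_space \<Rightarrow> real) \<Rightarrow> real \<times> 'a \<Rightarrow> real" where
  "space_neg_laplacian_pow m \<phi> = (\<lambda>(t, x). (neg_laplacian ^^ m) (\<lambda>y. \<phi> (t, y)) x)"

section \<open>Function spaces\<close>

text \<open>Elements of Lebesgue and Sobolev spaces are represented by functions; all notions below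
  depend only on almost-everywhere classes.\<close>

definition Lp :: "real \<Rightarrow> 'a::euclidean_space set \<Rightarrow> ('a \<Rightarrow> 'b::{banach, second_countable_topology}) set"
  where "Lp r S = {f \<in> borel_measurable (lebesgue_on S).
                     integrable (lebesgue_on S) (\<lambda>x. norm (f x) powr r)}"

definition local_Lp :: "real \<Rightarrow> 'a::euclidean_space set \<Rightarrow> ('a \<Rightarrow> real) set" where
  "local_Lp r S = {f. \<forall>K. compact K \<and> K \<subseteq> S \<longrightarrow> f \<in> Lp r K}"

definition L2_norm :: "('a::euclidean_space \<Rightarrow> 'b::{banach, second_countable_topology}) \<Rightarrow> real" where
  "L2_norm f = sqrt (LINT x|lebesgue. (norm (f x))\<^sup>2)"

text \<open>The unitary Fourier transform on \<open>L\<^sup>2\<close>, obtained as the \<open>L\<^sup>2\<close> limit, for \<open>R \<rightarrow> \<infinity>\<close>, of the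
  Fourier integrals over the balls of radius \<open>R\<close> (Plancherel); it is determined up to null sets.\<close>

definition fourier_integral :: "('a::euclidean_space \<Rightarrow> real) \<Rightarrow> real \<Rightarrow> 'a \<Rightarrow> complex" where
  "fourier_integral f R \<xi> =
     (2 * pi) powr (- real DIM('a) / 2) *\<^sub>R
     (LINT x|lebesgue_on (cball 0 R). cis (- (x \<bullet> \<xi>)) * complex_of_real (f x))"

definition fourier :: "('a::euclidean_space \<Rightarrow> real) \<Rightarrow> 'a \<Rightarrow> complex" where
  "fourier f = (SOME F. F \<in> Lp 2 UNIV \<and>
                 ((\<lambda>R. L2_norm (\<lambda>\<xi>. fourier_integral f R \<xi> - F \<xi>)) \<longlongrightarrow> 0) at_top)"

definition bessel_weighted_fourier :: "real \<Rightarrow> ('a::euclidean_space \<Rightarrow> real) \<Rightarrow> 'a \<Rightarrow> complex" where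
  "bessel_weighted_fourier a f \<xi> = (1 + (norm \<xi>)\<^sup>2) powr (a / 2) *\<^sub>R fourier f \<xi>"

text \<open>The Bessel potential space of order \<open>a \<ge> 0\<close> and its norm.\<close>

definition sobolev :: "real \<Rightarrow> ('a::euclidean_space \<Rightarrow> real) set" where
  "sobolev a = {f \<in> Lp 2 UNIV. bessel_weighted_fourier a f \<in> Lp 2 UNIV}"

definition sobolev_norm :: "real \<Rightarrow> ('a::euclidean_space \<Rightarrow> real) \<Rightarrow> real" where
  "sobolev_norm a f = L2_norm (bessel_weighted_fourier a f)"

section \<open>Curves in function spaces\<close>

text \<open>The interval \<open>[0,T)\<close>, where \<open>T = \<infinity>\<close> is allowed.\<close>

definition time_interval :: "ereal \<Rightarrow> real set" where
  "time_interval T = {t. 0 \<le> t \<and> ereal t < T}"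

definition C_time_sobolev :: "ereal \<Rightarrow> real \<Rightarrow> (real \<Rightarrow> 'a::euclidean_space \<Rightarrow> real) set" where
  "C_time_sobolev T a = {u. \<forall>t\<in>time_interval T. u t \<in> sobolev a \<and>
     ((\<lambda>s. sobolev_norm a (\<lambda>x. u s x - u t x)) \<longlongrightarrow> 0) (at t within time_interval T)}"

definition C_time_L2 :: "ereal \<Rightarrow> (real \<Rightarrow> 'a::euclidean_space \<Rightarrow> real) set" where
  "C_time_L2 T = {u. \<forall>t\<in>time_interval T. u t \<in> Lp 2 UNIV \<and>
     ((\<lambda>s. L2_norm (\<lambda>x. u s x - u t x)) \<longlongrightarrow> 0) (at t within time_interval T)}"

definition C1_time_L2 :: "ereal \<Rightarrow> (real \<Rightarrow> 'a::euclidean_space \<Rightarrow> real) set" where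
  "C1_time_L2 T = {u \<in> C_time_L2 T. \<exists>u'\<in>C_time_L2 T. \<forall>t\<in>time_interval T.
     ((\<lambda>s. L2_norm (\<lambda>x. (u s x - u t x) / (s - t) - u' t x)) \<longlongrightarrow> 0) (at t within time_interval T)}"

section \<open>Initial data\<close>

definition k_minus :: "nat \<Rightarrow> nat \<Rightarrow> nat" where
  "k_minus \<sigma> \<delta> = min \<sigma> (2 * \<delta>)"

definition k_plus :: "nat \<Rightarrow> nat \<Rightarrow> nat" where
  "k_plus \<sigma> \<delta> = max \<sigma> (2 * \<delta>)"

definition data_space :: "real \<Rightarrow> (('a::euclidean_space \<Rightarrow> real) \<times> ('a \<Rightarrow> real)) set" where
  "data_space a = (Lp 1 UNIV \<inter> sobolev a) \<times> (Lp 1 UNIV \<inter> Lp 2 UNIV)"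

text \<open>\<open>w\<close> represents the distribution \<open>(-\<Delta>)\<^sup>m f\<close>. For \<open>f\<close> in the Sobolev space of order \<open>2 m\<close>
  such a \<open>w\<close> exists and is unique up to null sets, so the existential quantifiers over \<open>w\<close> below
  merely name the function \<open>(-\<Delta>)\<^sup>m f\<close>.\<close>

definition has_neg_laplacian_pow ::
    "nat \<Rightarrow> ('a::euclidean_space \<Rightarrow> real) \<Rightarrow> ('a \<Rightarrow> real) \<Rightarrow> bool" where
  "has_neg_laplacian_pow m f w \<longleftrightarrow> w \<in> local_Lp 1 UNIV \<and>
     (\<forall>\<psi>\<in>test_functions UNIV.
        (LINT x|lebesgue. f x * (neg_laplacian ^^ m) \<psi> x) = (LINT x|lebesgue. w x * \<psi> x))"

definition positive_mass :: "nat \<Rightarrow> ('a::euclidean_space \<Rightarrow> real) \<Rightarrow> ('a \<Rightarrow> real) \<Rightarrow> bool" where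
  "positive_mass \<delta> u\<^sub>0 u\<^sub>1 \<longleftrightarrow> (\<exists>w. has_neg_laplacian_pow \<delta> u\<^sub>0 w \<and>
     Liminf at_top (\<lambda>R. ereal (LINT x|lebesgue_on (cball 0 R). u\<^sub>1 x + w x)) > 0)"

section \<open>Solutions\<close>

text \<open>Weak form of \<open>u\<^sub>t\<^sub>t + (-\<Delta>)\<^sup>\<sigma> u + (-\<Delta>)\<^sup>\<delta> u\<^sub>t = \<bar>z\<bar>\<^sup>r\<close> with data \<open>u\<^sub>0, u\<^sub>1\<close>.
  A test function on \<open>[0,T) \<times> \<real>\<^sup>n\<close> is the restriction of a smooth function on \<open>\<real> \<times> \<real>\<^sup>n\<close> whose
  compact support lies in \<open>(-\<infinity>,T) \<times> \<real>\<^sup>n\<close>; it need not vanish at \<open>t = 0\<close>.\<close>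

definition weak_equation ::
    "nat \<Rightarrow> nat \<Rightarrow> real \<Rightarrow> ereal \<Rightarrow> ('a::euclidean_space \<Rightarrow> real) \<Rightarrow> ('a \<Rightarrow> real) \<Rightarrow>
     (real \<Rightarrow> 'a \<Rightarrow> real) \<Rightarrow> (real \<Rightarrow> 'a \<Rightarrow> real) \<Rightarrow> bool" where
  "weak_equation \<sigma> \<delta> r T u\<^sub>0 u\<^sub>1 u z \<longleftrightarrow> (\<exists>w. has_neg_laplacian_pow \<delta> u\<^sub>0 w \<and>
     (\<forall>\<phi>\<in>test_functions ({t. ereal t < T} \<times> UNIV).
        (LINT (t, x)|lebesgue_on (time_interval T \<times> UNIV). \<bar>z t x\<bar> powr r * \<phi> (t, x))
        + (LINT x|lebesgue. (u\<^sub>1 x + w x) * \<phi> (0, x))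
      = (LINT x|lebesgue. u\<^sub>0 x * time_deriv \<phi> (0, x))
        + (LINT (t, x)|lebesgue_on (time_interval T \<times> UNIV).
             u t x * (time_deriv (time_deriv \<phi>) (t, x)
                      - space_neg_laplacian_pow \<delta> (time_deriv \<phi>) (t, x)
                      + space_neg_laplacian_pow \<sigma> \<phi> (t, x)))))"

definition weak_solution ::
    "nat \<Rightarrow> nat \<Rightarrow> real \<Rightarrow> real \<Rightarrow> ereal \<Rightarrow> ('a::euclidean_space \<Rightarrow> real) \<Rightarrow> ('a \<Rightarrow> real) \<Rightarrow>
     ('a \<Rightarrow> real) \<Rightarrow> ('a \<Rightarrow> real) \<Rightarrow> (real \<Rightarrow> 'a \<Rightarrow> real) \<Rightarrow> (real \<Rightarrow> 'a \<Rightarrow> real) \<Rightarrow> bool" where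
  "weak_solution \<sigma> \<delta> p q T u\<^sub>0 u\<^sub>1 v\<^sub>0 v\<^sub>1 u v \<longleftrightarrow>
     (\<lambda>(t, x). u t x) \<in> local_Lp q (time_interval T \<times> UNIV) \<and>
     (\<lambda>(t, x). v t x) \<in> local_Lp p (time_interval T \<times> UNIV) \<and>
     weak_equation \<sigma> \<delta> p T u\<^sub>0 u\<^sub>1 u v \<and>
     weak_equation \<sigma> \<delta> q T v\<^sub>0 v\<^sub>1 v u"

text \<open>A solution is one function \<open>u\<close>, jointly measurable in \<open>(t, x)\<close> through \<^const>\<open>local_Lp\<close>, whose
  slice at every time is the value of the curve. Every continuous curve in \<open>L\<^sup>2\<close> has such a
  representative.\<close>

definition energy_solution ::
    "nat \<Rightarrow> nat \<Rightarrow> real \<Rightarrow> real \<Rightarrow> ereal \<Rightarrow> ('a::euclidean_space \<Rightarrow> real) \<Rightarrow> ('a \<Rightarrow> real) \<Rightarrow>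
     ('a \<Rightarrow> real) \<Rightarrow> ('a \<Rightarrow> real) \<Rightarrow> (real \<Rightarrow> 'a \<Rightarrow> real) \<Rightarrow> (real \<Rightarrow> 'a \<Rightarrow> real) \<Rightarrow> bool" where
  "energy_solution \<sigma> \<delta> p q T u\<^sub>0 u\<^sub>1 v\<^sub>0 v\<^sub>1 u v \<longleftrightarrow>
     weak_solution \<sigma> \<delta> p q T u\<^sub>0 u\<^sub>1 v\<^sub>0 v\<^sub>1 u v \<and>
     u \<in> C_time_sobolev T (k_plus \<sigma> \<delta>) \<inter> C1_time_L2 T \<and>
     v \<in> C_time_sobolev T (k_plus \<sigma> \<delta>) \<inter> C1_time_L2 T"

text \<open>Supremum of the existence times of all energy solutions with the given data; no uniqueness of
  local solutions is presupposed. The value is \<open>-\<infinity>\<close> if there is no local solution.\<close>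

definition blow_up_time ::
    "nat \<Rightarrow> nat \<Rightarrow> real \<Rightarrow> real \<Rightarrow> ('a::euclidean_space \<Rightarrow> real) \<Rightarrow> ('a \<Rightarrow> real) \<Rightarrow>
     ('a \<Rightarrow> real) \<Rightarrow> ('a \<Rightarrow> real) \<Rightarrow> ereal" where
  "blow_up_time \<sigma> \<delta> p q u\<^sub>0 u\<^sub>1 v\<^sub>0 v\<^sub>1 =
     Sup {T. 0 < T \<and> (\<exists>u v. energy_solution \<sigma> \<delta> p q T u\<^sub>0 u\<^sub>1 v\<^sub>0 v\<^sub>1 u v)}"

text \<open>The denominator of the exponent in the estimate of the blow-up time. The estimate has a meaning
  only if it is positive: otherwise the power of \<open>\<epsilon>\<close> would not grow as \<open>\<epsilon> \<rightarrow> 0\<close>, whereas the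
  blow-up time does whenever small data have long-lived solutions.\<close>

definition lifespan_denom :: "nat \<Rightarrow> nat \<Rightarrow> real \<Rightarrow> real \<Rightarrow> nat \<Rightarrow> real" where
  "lifespan_denom \<sigma> \<delta> p q n = k_minus \<sigma> \<delta> + 2 * \<sigma> * (q + 1) / (p * q) - n"

end

theory Submission
  imports Defs "HOL-Computational_Algebra.Polynomial"
begin

text \<open>The proof is the test function method. Put \<open>a = 2\<sigma> - k\<close> with \<open>k = min \<sigma> (2\<delta>)\<close>, and test both weak
  equations with a cutoff \<open>\<phi>\<close> adapted to the parabolic box \<open>0 \<le> t \<le> R\<^sup>a\<close>, \<open>\<bar>x\<bar> \<le> R\<close>. This choice of \<open>a\<close> makes
  each of the three terms of \<open>\<phi>\<^sub>t\<^sub>t - (-\<Delta>)\<^sup>\<delta> \<phi>\<^sub>t + (-\<Delta>)\<^sup>\<sigma> \<phi>\<close> at most of size \<open>R powr (-2\<sigma>)\<close>, and all of them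
  vanish on the box itself, where \<open>\<phi> = 1\<close>. The cutoff is a high power \<open>\<beta>\<^sup>l\<close> of a bump \<open>\<beta>\<close>: a derivative of
  order at most \<open>2\<sigma>\<close> still contains the factor \<open>\<beta> ^ (l - 2\<sigma>)\<close>, which for large \<open>l\<close> lies below
  \<open>\<phi> powr (1/p)\<close> and \<open>\<phi> powr (1/q)\<close>. Hence Young's inequality with a free weight turns each equation into

  \<open>I + m \<le> c J + C c powr (-b) R\<^sup>e\<close>,

  where \<open>I\<close> is the weighted integral of the source, \<open>J\<close> that of the unknown over the part of the support
  outside the box, \<open>m > 0\<close> a lower bound for the pairing of the data with \<open>\<phi>\<close>, and
  \<open>b > 0\<close> (\<open>weak_equation_estimate\<close>). The lower bound \<open>m\<close> survives the passage from balls to cutoffs because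
  a radially decreasing cutoff is an average of indicators of balls (\<open>integral_mult_ge_of_ball_superlevels\<close>).

  Feeding the equation for \<open>v\<close> into the one for \<open>u\<close>, with weights \<open>K' R\<^sup>s\<close> and \<open>K R\<^sup>-\<^sup>s\<close> where \<open>s\<close> balances the two
  error terms, gives (\<open>system_estimate\<close>)

  \<open>I + m \<le> K K' I\<^sub>o + C(K, K') R powr (-D)\<close>, with \<open>D = k + 2\<sigma>(1 + p)/(pq - 1) - n\<close>,

  for the mass \<open>I\<close> of \<open>\<bar>v\<bar> powr p\<close> and its part \<open>I\<^sub>o\<close> outside the box, where \<open>C(K, K')\<close> becomes small if first
  \<open>K'\<close> and then \<open>K\<close> is chosen large. By symmetry \<open>p\<close> and \<open>q\<close> may be interchanged.

  If \<open>D \<ge> 0\<close> and the solution is global, then \<open>K K' < 1\<close> shows that \<open>I\<close> stays bounded as \<open>R \<rightarrow> \<infinity>\<close>. Then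
  \<open>\<bar>v\<bar> powr p\<close> is integrable, so \<open>I\<^sub>o\<close> tends to 0 along \<open>R = 2\<^sup>i R\<^sub>0\<close>, and \<open>m \<le> C(K, K')\<close> follows for all \<open>K, K'\<close>,
  which is absurd (\<open>no_global_weak_solution\<close>); this also covers the critical case \<open>D = 0\<close>. If \<open>D > 0\<close> and
  the data are scaled by \<open>\<epsilon>\<close>, then \<open>K = K' = 1\<close> gives \<open>\<epsilon> m \<le> C R powr (-D)\<close> as long as the support of \<open>\<phi>\<close>
  fits into the existence interval, that is, \<open>T\<close> is at most of order \<open>\<epsilon> powr (-a/D)\<close>. The exponent in the
  theorem has the denominator \<open>k + 2\<sigma>(q + 1)/(pq) - n\<close>, which is at most \<open>D\<close> with \<open>p\<close> and \<open>q\<close> interchanged, so the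
  bound it states follows for small \<open>\<epsilon>\<close> (\<open>lifespan_estimate\<close>).\<close>

section \<open>Calculus of smooth functions\<close>

lemma C_k_continuous: "C_k k f \<Longrightarrow> continuous_on UNIV f"
  by (cases k) (auto intro: differentiable_imp_continuous_on)

lemma C_k_SucD: "C_k (Suc k) f \<Longrightarrow> C_k k f"
proof (induction k arbitrary: f)
  case 0
  from C_k_continuous[OF this] show ?case by simp
next
  case (Suc k)
  from Suc.prems have "f differentiable_on UNIV"
    "\<And>b. b \<in> Basis \<Longrightarrow> C_k (Suc k) (\<lambda>x. frechet_derivative f (at x) b)"
    unfolding C_k.simps(2)[of "Suc k"] by blast+
  then show ?case
    unfolding C_k.simps(2)[of k f] using Suc.IH by blast
qed

lemma C_k_differentiable: "C_k (Suc k) f \<Longrightarrow> f differentiable (at x)"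
  by (simp add: differentiable_on_def)

text \<open>The class \<open>C_k\<close> is defined through \<^const>\<open>frechet_derivative\<close>, a choice operator. This rule and the
  next one exchange it for an arbitrary family of derivatives, to which the rules of differentiation apply.\<close>

lemma C_k_SucI:
  assumes "\<And>x. (f has_derivative f' x) (at x)" "\<And>b. b \<in> Basis \<Longrightarrow> C_k k (\<lambda>x. f' x b)"
  shows "C_k (Suc k) f"
proof -
  have "frechet_derivative f (at x) = f' x" for x
    using assms(1) frechet_derivative_at by metis
  then show ?thesis
    using assms by (auto simp: differentiable_on_def differentiable_def intro: has_derivative_at_withinI)
qed

lemma C_k_SucE:
  assumes "C_k (Suc k) f"
  obtains f' where "\<And>x. (f has_derivative f' x) (at x)" "\<And>b. b \<in> Basis \<Longrightarrow> C_k k (\<lambda>x. f' x b)"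
proof (rule that)
  show "(f has_derivative frechet_derivative f (at x)) (at x)" for x
    using C_k_differentiable[OF assms] frechet_derivative_works by blast
  show "C_k k (\<lambda>x. frechet_derivative f (at x) b)" if "b \<in> Basis" for b
    using assms that unfolding C_k.simps by blast
qed

lemma C_k_const [simp]: "C_k k (\<lambda>x. c)"
proof (induction k arbitrary: c)
  case (Suc k)
  show ?case by (rule C_k_SucI[where f' = "\<lambda>x y. 0"]) (auto intro: Suc)
qed simp

lemma C_k_bounded_linear:
  assumes "bounded_linear f"
  shows "C_k k f"
proof (cases k)
  case (Suc j)
  show ?thesis unfolding Suc
    by (rule C_k_SucI[where f' = "\<lambda>x. f"]) (auto intro: bounded_linear_imp_has_derivative assms)
qed (use assms in \<open>auto intro: linear_continuous_on\<close>)

lemma C_k_add: "C_k k f \<Longrightarrow> C_k k g \<Longrightarrow> C_k k (\<lambda>x. f x + g x)"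
proof (induction k arbitrary: f g)
  case (Suc k)
  obtain f' where f': "\<And>x. (f has_derivative f' x) (at x)" "\<And>b. b \<in> Basis \<Longrightarrow> C_k k (\<lambda>x. f' x b)"
    using C_k_SucE[OF Suc.prems(1)] by metis
  obtain g' where g': "\<And>x. (g has_derivative g' x) (at x)" "\<And>b. b \<in> Basis \<Longrightarrow> C_k k (\<lambda>x. g' x b)"
    using C_k_SucE[OF Suc.prems(2)] by metis
  show ?case
    by (rule C_k_SucI[where f' = "\<lambda>x y. f' x y + g' x y"])
       (auto intro!: has_derivative_add f' g' Suc.IH)
qed (auto intro: continuous_on_add)

lemma C_k_mult: "C_k k f \<Longrightarrow> C_k k g \<Longrightarrow> C_k k (\<lambda>x. f x * g x)"
proof (induction k arbitrary: f g)
  case (Suc k)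
  obtain f' where f': "\<And>x. (f has_derivative f' x) (at x)" "\<And>b. b \<in> Basis \<Longrightarrow> C_k k (\<lambda>x. f' x b)"
    using C_k_SucE[OF Suc.prems(1)] by metis
  obtain g' where g': "\<And>x. (g has_derivative g' x) (at x)" "\<And>b. b \<in> Basis \<Longrightarrow> C_k k (\<lambda>x. g' x b)"
    using C_k_SucE[OF Suc.prems(2)] by metis
  show ?case
    by (rule C_k_SucI[where f' = "\<lambda>x y. f x * g' x y + f' x y * g x"])
       (auto intro!: has_derivative_mult f' g' Suc.IH C_k_add Suc.prems[THEN C_k_SucD])
qed (auto intro: continuous_on_mult)

lemma C_k_compose:
  fixes g :: "real \<Rightarrow> real"
  shows "C_k k g \<Longrightarrow> C_k k f \<Longrightarrow> C_k k (\<lambda>x. g (f x))"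
proof (induction k arbitrary: g)
  case 0
  then show ?case by (auto intro: continuous_on_compose2[of UNIV g])
next
  case (Suc k)
  obtain f' where f': "\<And>x. (f has_derivative f' x) (at x)" "\<And>b. b \<in> Basis \<Longrightarrow> C_k k (\<lambda>x. f' x b)"
    using C_k_SucE[OF Suc.prems(2)] by metis
  obtain g' where g': "\<And>x. (g has_derivative g' x) (at x)" "\<And>b. b \<in> Basis \<Longrightarrow> C_k k (\<lambda>x. g' x b)"
    using C_k_SucE[OF Suc.prems(1)] by metis
  have *: "g' x y = g' x 1 * y" for x y
    using linear_cmul[OF has_derivative_linear[OF g'(1)], of x y 1] by simp
  show ?case
  proof (rule C_k_SucI)
    show "((\<lambda>x. g (f x)) has_derivative (\<lambda>y. g' (f x) 1 * f' x y)) (at x)" for x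
      by (rule has_derivative_eq_rhs[OF has_derivative_compose[OF f'(1) g'(1)] ext]) (rule *)
    show "C_k k (\<lambda>x. g' (f x) 1 * f' x b)" if "b \<in> Basis" for b
      by (rule C_k_mult[OF Suc.IH[OF g'(2) C_k_SucD[OF Suc.prems(2)]] f'(2)[OF that]]) simp
  qed
qed

lemma C_k_scale: "C_k k f \<Longrightarrow> C_k k (\<lambda>x. f (c *\<^sub>R x))"
proof (induction k arbitrary: f)
  case 0
  then show ?case by (auto intro!: continuous_on_compose2[of UNIV f] continuous_intros)
next
  case (Suc k)
  obtain f' where f': "\<And>x. (f has_derivative f' x) (at x)" "\<And>b. b \<in> Basis \<Longrightarrow> C_k k (\<lambda>x. f' x b)"
    using C_k_SucE[OF Suc.prems(1)] by metis
  have *: "f' x (c *\<^sub>R y) = c * f' x y" for x y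
    using linear_cmul[OF has_derivative_linear[OF f'(1)], of x c y] by simp
  show ?case
  proof (rule C_k_SucI)
    show "((\<lambda>x. f (c *\<^sub>R x)) has_derivative (\<lambda>y. c * f' (c *\<^sub>R x) y)) (at x)" for x
      by (rule has_derivative_eq_rhs[OF has_derivative_compose[OF _ f'(1)]])
         (auto intro!: derivative_eq_intros simp: *)
    show "C_k k (\<lambda>x. c * f' (c *\<^sub>R x) b)" if "b \<in> Basis" for b
      by (intro C_k_mult C_k_const Suc.IH f' that)
  qed
qed

lemma smooth_const: "smooth (\<lambda>x. c)" by (simp add: smooth_def)
lemma smooth_bounded_linear: "bounded_linear f \<Longrightarrow> smooth f"
  by (simp add: smooth_def C_k_bounded_linear)
lemma smooth_add: "smooth f \<Longrightarrow> smooth g \<Longrightarrow> smooth (\<lambda>x. f x + g x)"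
  by (simp add: smooth_def C_k_add)
lemma smooth_mult: "smooth f \<Longrightarrow> smooth g \<Longrightarrow> smooth (\<lambda>x. f x * g x)"
  by (simp add: smooth_def C_k_mult)
lemma smooth_compose: "smooth g \<Longrightarrow> smooth f \<Longrightarrow> smooth (\<lambda>x. g (f x))" for g :: "real \<Rightarrow> real"
  by (simp add: smooth_def C_k_compose)
lemma smooth_scale: "smooth f \<Longrightarrow> smooth (\<lambda>x. f (c *\<^sub>R x))"
  by (simp add: smooth_def C_k_scale)
lemma smooth_uminus: "smooth f \<Longrightarrow> smooth (\<lambda>x. - f x)"
  using smooth_mult[OF smooth_const[of "-1"], of f] by simp
lemma smooth_power: "smooth f \<Longrightarrow> smooth (\<lambda>x. f x ^ n)"
  by (induction n) (auto intro: smooth_const smooth_mult)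
lemma smooth_sum: "finite A \<Longrightarrow> (\<And>i. i \<in> A \<Longrightarrow> smooth (f i)) \<Longrightarrow> smooth (\<lambda>x. \<Sum>i\<in>A. f i x)"
  by (induction A rule: finite_induct) (auto intro: smooth_const smooth_add)

lemma smooth_continuous: "smooth f \<Longrightarrow> continuous_on A f"
  using C_k_continuous continuous_on_subset smooth_def by blast

lemma smooth_differentiable: "smooth f \<Longrightarrow> f differentiable (at x)"
  using C_k_differentiable smooth_def by blast

text \<open>Membership in any class of functions closed under differentiation suffices for smoothness; the
  flat exponentials below form such a class.\<close>

lemma smooth_coinduct:
  assumes "X f"
    and "\<And>f. X f \<Longrightarrow> \<exists>f'. (\<forall>x. (f has_derivative f' x) (at x)) \<and> (\<forall>b\<in>Basis. X (\<lambda>x. f' x b))"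
  shows "smooth f"
proof -
  have "X f \<Longrightarrow> C_k k f" for k f
  proof (induction k arbitrary: f)
    case 0
    then obtain f' where "\<And>x. (f has_derivative f' x) (at x)" using assms(2) by metis
    then show ?case by (auto intro: has_derivative_continuous_on)
  next
    case (Suc k)
    then obtain f' where "\<forall>x. (f has_derivative f' x) (at x)" "\<forall>b\<in>Basis. X (\<lambda>x. f' x b)"
      using assms(2) by metis
    then show ?case using Suc.IH by (intro C_k_SucI) auto
  qed
  then show ?thesis using assms(1) smooth_def by blast
qed

lemma smooth_has_partial_deriv_frechet:
  assumes "smooth f"
  shows "((\<lambda>s. f (x + s *\<^sub>R b)) has_real_derivative frechet_derivative f (at (x + s *\<^sub>R b)) b) (at s)"
proof -
  have f: "(f has_derivative frechet_derivative f (at y)) (at y)" for y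
    using assms frechet_derivative_works smooth_differentiable by blast
  have "((\<lambda>s. f (x + s *\<^sub>R b)) has_derivative (\<lambda>h. frechet_derivative f (at (x + s *\<^sub>R b)) (h *\<^sub>R b))) (at s)"
    by (rule has_derivative_compose[OF _ f]) (auto intro!: derivative_eq_intros)
  moreover have "(\<lambda>h. frechet_derivative f (at (x + s *\<^sub>R b)) (h *\<^sub>R b))
      = (*) (frechet_derivative f (at (x + s *\<^sub>R b)) b)"
    by (rule ext) (simp add: linear_cmul[OF has_derivative_linear[OF f]])
  ultimately show ?thesis
    by (simp add: has_field_derivative_def)
qed

lemma partial_deriv_frechet:
  assumes "smooth f"
  shows "partial_deriv b f x = frechet_derivative f (at x) b"
  unfolding partial_deriv_def
  using DERIV_imp_deriv[OF smooth_has_partial_deriv_frechet[OF assms, of x b 0]] by simp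

lemma smooth_has_partial_deriv:
  assumes "smooth f"
  shows "((\<lambda>s. f (x + s *\<^sub>R b)) has_real_derivative partial_deriv b f (x + s *\<^sub>R b)) (at s)"
  using smooth_has_partial_deriv_frechet[OF assms] by (simp add: partial_deriv_frechet[OF assms])

lemma partial_deriv_eqI:
  assumes "((\<lambda>s. f (x + s *\<^sub>R b)) has_real_derivative D) (at 0)"
  shows "partial_deriv b f x = D"
  using assms DERIV_imp_deriv unfolding partial_deriv_def by blast

lemma smooth_partial_deriv: "smooth f \<Longrightarrow> b \<in> Basis \<Longrightarrow> smooth (partial_deriv b f)"
  using partial_deriv_frechet[of f b] C_k.simps(2)[of _ f] unfolding smooth_def
  by (metis (no_types, lifting) ext)

lemma partial_deriv_mult:
  assumes "smooth f" "smooth g"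
  shows "partial_deriv b (\<lambda>x. f x * g x) = (\<lambda>x. partial_deriv b f x * g x + f x * partial_deriv b g x)"
proof
  fix x
  show "partial_deriv b (\<lambda>x. f x * g x) x = partial_deriv b f x * g x + f x * partial_deriv b g x"
    using DERIV_mult[OF smooth_has_partial_deriv[OF assms(1), of x b 0]
        smooth_has_partial_deriv[OF assms(2), of x b 0]]
    by (intro partial_deriv_eqI) (simp add: algebra_simps)
qed

lemma partial_deriv_scale:
  assumes "smooth f"
  shows "partial_deriv b (\<lambda>x. a * f (c *\<^sub>R x)) = (\<lambda>x. a * c * partial_deriv b f (c *\<^sub>R x))"
proof
  fix x
  have "((\<lambda>s. f (c *\<^sub>R x + (c * s) *\<^sub>R b)) has_real_derivative partial_deriv b f (c *\<^sub>R x) * c) (at 0)"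
    by (rule DERIV_chain2[where f = "\<lambda>s. f (c *\<^sub>R x + s *\<^sub>R b)" and g = "\<lambda>s. c * s"])
       (use smooth_has_partial_deriv[OF assms, of "c *\<^sub>R x" b 0] in \<open>auto intro!: derivative_eq_intros\<close>)
  then have "((\<lambda>s. a * f (c *\<^sub>R (x + s *\<^sub>R b))) has_real_derivative a * c * partial_deriv b f (c *\<^sub>R x)) (at 0)"
    by (auto intro!: derivative_eq_intros simp: algebra_simps)
  then show "partial_deriv b (\<lambda>x. a * f (c *\<^sub>R x)) x = a * c * partial_deriv b f (c *\<^sub>R x)"
    by (rule partial_deriv_eqI)
qed

lemma smooth_neg_laplacian: "smooth f \<Longrightarrow> smooth (neg_laplacian f)"
  unfolding neg_laplacian_def[abs_def]
  by (intro smooth_uminus smooth_sum smooth_partial_deriv) auto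

lemma neg_laplacian_scale:
  assumes "smooth f"
  shows "neg_laplacian (\<lambda>x. a * f (c *\<^sub>R x)) = (\<lambda>x. a * c\<^sup>2 * neg_laplacian f (c *\<^sub>R x))"
proof -
  have "partial_deriv b (partial_deriv b (\<lambda>x. a * f (c *\<^sub>R x))) x
      = a * c\<^sup>2 * partial_deriv b (partial_deriv b f) (c *\<^sub>R x)" if "b \<in> Basis" for b x
    using that by (simp add: partial_deriv_scale assms smooth_partial_deriv power2_eq_square)
  then show ?thesis
    by (simp add: neg_laplacian_def fun_eq_iff sum_distrib_left)
qed

lemma smooth_neg_laplacian_pow: "smooth f \<Longrightarrow> smooth ((neg_laplacian ^^ m) f)"
  by (induction m) (auto intro: smooth_neg_laplacian)

lemma neg_laplacian_pow_scale:
  assumes "smooth f"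
  shows "(neg_laplacian ^^ m) (\<lambda>x. a * f (c *\<^sub>R x)) = (\<lambda>x. a * c ^ (2 * m) * (neg_laplacian ^^ m) f (c *\<^sub>R x))"
proof (induction m)
  case (Suc m)
  have "c ^ (2 * Suc m) = c ^ (2 * m) * c\<^sup>2"
    by (simp add: power2_eq_square)
  then show ?case
    unfolding funpow.simps o_apply Suc.IH neg_laplacian_scale[OF smooth_neg_laplacian_pow[OF assms]]
    by (simp only: mult.assoc)
qed simp

text \<open>Treating \<^const>\<open>deriv\<close> as a partial derivative on the line lets the time and space factors of a cutoff
  share one calculus.\<close>

lemma deriv_eq_partial_deriv: "deriv f = partial_deriv 1 f" for f :: "real \<Rightarrow> real"
proof
  fix t
  have "(f has_real_derivative D) (at t) \<longleftrightarrow> ((\<lambda>s. f (t + s)) has_real_derivative D) (at 0)" for D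
    using DERIV_shift[of f D 0 t] by (simp add: add.commute)
  then show "deriv f t = partial_deriv 1 f t"
    by (simp add: deriv_def partial_deriv_def)
qed

section \<open>A smooth radial bump\<close>

lemma tendsto_poly_exp_0: "((\<lambda>y::real. poly P y * exp (- y)) \<longlongrightarrow> 0) at_top"
proof -
  have "((\<lambda>y::real. \<Sum>i\<le>degree P. coeff P i * (y ^ i / exp y)) \<longlongrightarrow> (\<Sum>i\<le>degree P. coeff P i * 0)) at_top"
    by (intro tendsto_sum tendsto_mult tendsto_const tendsto_power_div_exp_0)
  moreover have "poly P y * exp (- y) = (\<Sum>i\<le>degree P. coeff P i * (y ^ i / exp y))" for y :: real
    by (simp add: poly_altdef exp_minus sum_distrib_right divide_inverse mult.assoc)
  ultimately show ?thesis by simp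
qed

text \<open>The functions \<open>P(1/s) exp(-1/s)\<close>, continued by 0 to \<open>s \<le> 0\<close>: since
  \<open>(P(1/s) exp(-1/s))' = s\<^sup>-\<^sup>2 (P - P')(1/s) exp(-1/s)\<close>, the derivatives of \<open>exp(-1/s)\<close> never leave this family.\<close>

definition flat_exp :: "real poly \<Rightarrow> real \<Rightarrow> real" where
  "flat_exp P s = (if 0 < s then poly P (1 / s) * exp (- (1 / s)) else 0)"

lemma flat_exp_has_derivative:
  "(flat_exp P has_real_derivative flat_exp ([:0, 0, 1:] * (P - pderiv P)) s) (at s)"
proof (cases s "0::real" rule: linorder_cases)
  case less
  have "(flat_exp P has_real_derivative 0) (at s)"
    by (rule has_field_derivative_transform_within_open[OF DERIV_const, where S = "{..<0}"])
       (use less in \<open>auto simp: flat_exp_def\<close>)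
  then show ?thesis
    using less by (simp add: flat_exp_def)
next
  case greater
  have "((\<lambda>s. poly P (1 / s) * exp (- (1 / s))) has_real_derivative
      poly (pderiv P) (1 / s) * (- (1 / s\<^sup>2)) * exp (- (1 / s)) + exp (- (1 / s)) * (1 / s\<^sup>2) * poly P (1 / s)) (at s)"
    using greater
    by (auto intro!: derivative_eq_intros DERIV_chain2[OF poly_DERIV] simp: power2_eq_square divide_inverse)
  then have "((\<lambda>s. poly P (1 / s) * exp (- (1 / s))) has_real_derivative
      flat_exp ([:0, 0, 1:] * (P - pderiv P)) s) (at s)"
    using greater by (simp add: flat_exp_def power2_eq_square field_simps)
  then show ?thesis
    using greater by (rule_tac has_field_derivative_transform_within_open[where S = "{0<..}"])
       (auto simp: flat_exp_def)
next
  case equal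
  have "((\<lambda>h. poly ([:0, 1:] * P) (1 / h) * exp (- (1 / h))) \<longlongrightarrow> 0) (at_right 0)"
    using filterlim_compose[OF tendsto_poly_exp_0[of "[:0, 1:] * P"] filterlim_inverse_at_top_right]
    by (simp add: divide_inverse)
  moreover have "eventually (\<lambda>h. poly ([:0, 1:] * P) (1 / h) * exp (- (1 / h)) = flat_exp P h / h) (at_right 0)"
    by (auto simp: flat_exp_def eventually_at_filter)
  ultimately have "((\<lambda>h. flat_exp P h / h) \<longlongrightarrow> 0) (at_right 0)"
    by (rule Lim_transform_eventually)
  moreover have "((\<lambda>h. flat_exp P h / h) \<longlongrightarrow> 0) (at_left 0)"
    by (rule tendsto_eventually) (auto simp: flat_exp_def eventually_at_filter)
  ultimately have "((\<lambda>h. flat_exp P h / h) \<longlongrightarrow> 0) (at 0)"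
    by (simp add: filterlim_at_split)
  then show ?thesis
    by (simp add: equal DERIV_def flat_exp_def)
qed

lemma smooth_flat_exp: "smooth (flat_exp P)"
proof (rule smooth_coinduct[where X = "\<lambda>f. \<exists>P. f = flat_exp P"])
  fix f :: "real \<Rightarrow> real" assume "\<exists>P. f = flat_exp P"
  then obtain P where f: "f = flat_exp P" by blast
  let ?Q = "[:0, 0, 1:] * (P - pderiv P)"
  have "(f has_derivative (\<lambda>y. flat_exp ?Q x * y)) (at x)" for x
    using flat_exp_has_derivative[of P x] unfolding f has_field_derivative_def .
  then show "\<exists>f'. (\<forall>x. (f has_derivative f' x) (at x)) \<and> (\<forall>b\<in>Basis. \<exists>P. (\<lambda>x. f' x b) = flat_exp P)"
    by (intro exI[of _ "\<lambda>x y. flat_exp ?Q x * y"]) auto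
qed blast

definition hump :: "real \<Rightarrow> real" where
  "hump s = flat_exp 1 s"

lemma hump_eq: "hump s = (if 0 < s then exp (- (1 / s)) else 0)"
  by (simp add: hump_def flat_exp_def)

lemma hump_nonneg: "0 \<le> hump s" by (simp add: hump_eq)

lemma hump_mono: "s \<le> t \<Longrightarrow> hump s \<le> hump t"
  by (auto simp: hump_eq frac_le)

text \<open>A smooth decreasing step made of compositions only, without a quotient of functions or an integral:
  \<open>hump (s - 1)\<close> vanishes for \<open>s \<le> 1\<close> and is at least \<open>hump 1\<close> for \<open>s \<ge> 2\<close>.\<close>

definition transition :: "real \<Rightarrow> real" where
  "transition s = hump (hump 1 - hump (s - 1)) / hump (hump 1)"

lemma hump_pos: "0 < s \<Longrightarrow> 0 < hump s" by (simp add: hump_eq)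

lemma transition_eq_1: "s \<le> 1 \<Longrightarrow> transition s = 1"
  using hump_pos[OF hump_pos[of 1]] by (simp add: transition_def hump_eq[of "s - 1"])

lemma transition_eq_0: "2 \<le> s \<Longrightarrow> transition s = 0"
  using hump_mono[of 1 "s - 1"] by (simp add: transition_def hump_eq[of "hump 1 - _"])

lemma transition_antimono: "s \<le> t \<Longrightarrow> transition t \<le> transition s"
  unfolding transition_def by (intro divide_right_mono hump_mono hump_nonneg diff_left_mono) auto

lemma transition_nonneg: "0 \<le> transition s"
  by (simp add: transition_def hump_nonneg)

lemma transition_le_1: "transition s \<le> 1"
  using transition_antimono[of 1 s] transition_eq_1[of s] transition_eq_1[of 1] by linarith

lemma smooth_transition: "smooth transition"
proof -
  have h: "smooth hump" using smooth_flat_exp hump_def by presburger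
  have "smooth (\<lambda>s. hump (hump 1 + - hump (s + (-1))) * inverse (hump (hump 1)))"
    by (intro smooth_mult smooth_const smooth_compose[OF h] smooth_add smooth_uminus
        smooth_bounded_linear bounded_linear_ident)
  then show ?thesis by (simp add: transition_def[abs_def] divide_inverse)
qed

text \<open>The factor \<open>1/2\<close> makes the plateau, the ball of radius \<open>sqrt 2\<close>, a neighbourhood of the closed unit
  ball, so that all derivatives vanish on the latter; the support is the ball of radius 2.\<close>

definition bump :: "'a::euclidean_space \<Rightarrow> real" where
  "bump x = transition ((norm x)\<^sup>2 / 2)"

lemma smooth_bump: "smooth bump"
proof -
  have "smooth (\<lambda>x::'a. transition ((\<Sum>b\<in>Basis. (x \<bullet> b) * (x \<bullet> b)) * (1/2)))"
    by (intro smooth_compose[OF smooth_transition] smooth_mult smooth_const smooth_sum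
        smooth_bounded_linear bounded_linear_inner_left) auto
  moreover have "(\<Sum>b\<in>Basis. (x \<bullet> b) * (x \<bullet> b)) = (norm x)\<^sup>2" for x :: 'a
    by (simp add: euclidean_inner[of x x, symmetric] power2_norm_eq_inner)
  ultimately show ?thesis by (simp add: bump_def[abs_def])
qed

lemma bump_nonneg [simp]: "0 \<le> bump x" by (simp add: bump_def transition_nonneg)
lemma bump_le_1 [simp]: "bump x \<le> 1" by (simp add: bump_def transition_le_1)

lemma bump_eq_1: "(norm x)\<^sup>2 \<le> 2 \<Longrightarrow> bump x = 1"
  by (simp add: bump_def transition_eq_1)

lemma bump_eq_0: "2 \<le> norm x \<Longrightarrow> bump x = 0"
  using power_mono[of 2 "norm x" 2] by (simp add: bump_def transition_eq_0)

text \<open>The bump is continuous and decreases with the norm, so the radii at which its power is at least \<open>c\<close>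
  form a compact interval starting at 0.\<close>

lemma bump_superlevel_ball:
  assumes "0 < c" "c \<le> 1" "0 < l"
  obtains r where "1 \<le> r" "{x::'a::euclidean_space. c \<le> bump x ^ l} = cball 0 r"
proof -
  define g where "g s = transition (s\<^sup>2 / 2) ^ l" for s
  have "smooth (\<lambda>s. transition ((s * s) * (1 / 2)) ^ l)"
    by (intro smooth_power smooth_compose[OF smooth_transition] smooth_mult smooth_const
        smooth_bounded_linear bounded_linear_ident)
  then have cont: "continuous_on UNIV g"
    unfolding g_def power2_eq_square by (intro smooth_continuous) simp
  define S where "S = {1..2} \<inter> {s. c \<le> g s}"
  have "closed {s. c \<le> g s}"
    using closed_Collect_le[OF continuous_on_const cont] .
  then have "compact S" unfolding S_def by (intro compact_Int_closed) auto
  moreover have "1 \<in> S" using assms by (simp add: S_def g_def transition_eq_1)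
  ultimately obtain r where r: "r \<in> S" "\<And>s. s \<in> S \<Longrightarrow> s \<le> r"
    using compact_attains_sup[of S] by blast
  have g1: "g s = 1" if "0 \<le> s" "s \<le> 1" for s
    using that power_mono[of s 1 2] by (simp add: g_def transition_eq_1)
  have g0: "g s = 0" if "2 \<le> s" for s
    using that power_mono[of 2 s 2] assms by (simp add: g_def transition_eq_0)
  have "c \<le> g s \<longleftrightarrow> s \<le> r" if "0 \<le> s" for s
  proof
    assume "c \<le> g s"
    then have "s < 2" using g0[of s] assms by force
    then show "s \<le> r" using r \<open>c \<le> g s\<close> unfolding S_def by (cases "1 \<le> s") auto
  next
    assume "s \<le> r"
    then have "g r \<le> g s" using that unfolding g_def
      by (intro power_mono transition_antimono transition_nonneg divide_right_mono) (auto intro: power_mono)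
    then show "c \<le> g s" using r(1) by (simp add: S_def)
  qed
  then have "{x::'a. c \<le> bump x ^ l} = cball 0 r"
    by (auto simp: g_def bump_def)
  then show ?thesis using that[of r] r(1) by (auto simp: S_def)
qed

section \<open>Derivatives of powers of the bump\<close>

text \<open>Differentiation costs one factor \<open>\<Phi>\<close>: \<open>\<partial>(\<Phi>\<^sup>j\<^sup>+\<^sup>1 g) = \<Phi>\<^sup>j ((j + 1) \<partial>\<Phi> g + \<Phi> \<partial>g)\<close>. This is what later bounds the
  derivatives of a power of the bump by a smaller power of the bump itself.\<close>

lemma partial_deriv_power_mult:
  assumes "smooth \<Phi>" "smooth g" "b \<in> Basis"
  obtains g' where "smooth g'" "partial_deriv b (\<lambda>x. \<Phi> x ^ Suc j * g x) = (\<lambda>x. \<Phi> x ^ j * g' x)"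
proof -
  have pw: "partial_deriv b (\<lambda>x. \<Phi> x ^ Suc n) = (\<lambda>x. real (Suc n) * \<Phi> x ^ n * partial_deriv b \<Phi> x)" for n
  proof (induction n)
    case (Suc n)
    have "partial_deriv b (\<lambda>x. \<Phi> x * \<Phi> x ^ Suc n) =
        (\<lambda>x. partial_deriv b \<Phi> x * \<Phi> x ^ Suc n + \<Phi> x * partial_deriv b (\<lambda>x. \<Phi> x ^ Suc n) x)"
      by (intro partial_deriv_mult smooth_power assms)
    then show ?case unfolding Suc by (auto simp: algebra_simps)
  qed simp
  have "partial_deriv b (\<lambda>x. \<Phi> x ^ Suc j * g x) =
      (\<lambda>x. partial_deriv b (\<lambda>x. \<Phi> x ^ Suc j) x * g x + \<Phi> x ^ Suc j * partial_deriv b g x)"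
    by (intro partial_deriv_mult smooth_power assms)
  also have "\<dots> = (\<lambda>x. \<Phi> x ^ j * (real (Suc j) * partial_deriv b \<Phi> x * g x + \<Phi> x * partial_deriv b g x))"
    unfolding pw by (auto simp: algebra_simps)
  finally show ?thesis
    by (rule that[rotated]) (intro smooth_add smooth_mult smooth_const smooth_partial_deriv assms)
qed

lemma neg_laplacian_power_mult:
  assumes "smooth \<Phi>" "smooth g"
  obtains g' where "smooth g'" "neg_laplacian (\<lambda>x. \<Phi> x ^ (j + 2) * g x) = (\<lambda>x. \<Phi> x ^ j * g' x)"
proof -
  have "\<exists>g'. smooth g' \<and> partial_deriv b (partial_deriv b (\<lambda>x. \<Phi> x ^ (j + 2) * g x)) = (\<lambda>x. \<Phi> x ^ j * g' x)"
    if b: "b \<in> Basis" for b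
  proof -
    obtain g1 where "smooth g1" "partial_deriv b (\<lambda>x. \<Phi> x ^ Suc (Suc j) * g x) = (\<lambda>x. \<Phi> x ^ Suc j * g1 x)"
      using partial_deriv_power_mult[OF assms b] by metis
    moreover obtain g2 where "smooth g2" "partial_deriv b (\<lambda>x. \<Phi> x ^ Suc j * g1 x) = (\<lambda>x. \<Phi> x ^ j * g2 x)"
      using partial_deriv_power_mult[OF assms(1) \<open>smooth g1\<close> b] by metis
    ultimately show ?thesis by auto
  qed
  then obtain G where G: "\<And>b. b \<in> Basis \<Longrightarrow> smooth (G b)"
    "\<And>b. b \<in> Basis \<Longrightarrow> partial_deriv b (partial_deriv b (\<lambda>x. \<Phi> x ^ (j + 2) * g x)) = (\<lambda>x. \<Phi> x ^ j * G b x)"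
    by metis
  show ?thesis
  proof (rule that)
    show "smooth (\<lambda>x. - (\<Sum>b\<in>Basis. G b x))" by (intro smooth_uminus smooth_sum G) auto
    show "neg_laplacian (\<lambda>x. \<Phi> x ^ (j + 2) * g x) = (\<lambda>x. \<Phi> x ^ j * - (\<Sum>b\<in>Basis. G b x))"
      unfolding neg_laplacian_def[abs_def] by (simp add: G(2) sum_distrib_left del: power_add power_Suc add_2_eq_Suc')
  qed
qed

lemma neg_laplacian_pow_power_mult:
  assumes "smooth \<Phi>" "smooth g"
  shows "\<exists>g'. smooth g' \<and> (neg_laplacian ^^ m) (\<lambda>x. \<Phi> x ^ (j + 2 * m) * g x) = (\<lambda>x. \<Phi> x ^ j * g' x)"
proof (induction m arbitrary: j)
  case 0
  then show ?case using assms by auto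
next
  case (Suc m)
  obtain g1 where g1: "smooth g1"
    "(neg_laplacian ^^ m) (\<lambda>x. \<Phi> x ^ (j + 2 + 2 * m) * g x) = (\<lambda>x. \<Phi> x ^ (j + 2) * g1 x)"
    using Suc[of "j + 2"] by blast
  obtain g2 where g2: "smooth g2" "neg_laplacian (\<lambda>x. \<Phi> x ^ (j + 2) * g1 x) = (\<lambda>x. \<Phi> x ^ j * g2 x)"
    using neg_laplacian_power_mult[OF assms(1) g1(1)] by metis
  have "j + 2 * Suc m = j + 2 + 2 * m" by simp
  then have "(neg_laplacian ^^ Suc m) (\<lambda>x. \<Phi> x ^ (j + 2 * Suc m) * g x) = (\<lambda>x. \<Phi> x ^ j * g2 x)"
    using g1(2) g2(2) by (simp only: funpow.simps o_apply)
  then show ?case using g2(1) by blast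
qed

text \<open>The smooth factor need not be bounded, but only its values on the support of the bump matter.\<close>

lemma bump_power_mult_bound:
  fixes g :: "'a::euclidean_space \<Rightarrow> real"
  assumes "smooth g" "0 < j"
  obtains B where "0 \<le> B" "\<And>x. \<bar>bump x ^ j * g x\<bar> \<le> B * bump x ^ j"
proof -
  have "compact (g ` cball 0 2)"
    by (intro compact_continuous_image smooth_continuous assms) auto
  then obtain B where B: "\<And>x. x \<in> cball 0 2 \<Longrightarrow> \<bar>g x\<bar> \<le> B"
    using compact_imp_bounded bounded_real by (metis imageI)
  have "\<bar>bump x ^ j * g x\<bar> \<le> B * bump x ^ j" for x
  proof (cases "x \<in> cball 0 2")
    case True
    then show ?thesis using mult_right_mono[OF B[OF True], of "bump x ^ j"]
      by (simp add: abs_mult mult.commute)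
  next
    case False
    then show ?thesis using assms by (simp add: bump_eq_0 zero_power)
  qed
  moreover have "0 \<le> B" using B[of 0] by force
  ultimately show ?thesis using that by blast
qed

lemma neg_laplacian_pow_bump_bound:
  assumes "0 < j" "j + 2 * m \<le> l"
  obtains B where "0 \<le> B" "\<And>x::'a::euclidean_space. \<bar>(neg_laplacian ^^ m) (\<lambda>x. bump x ^ l) x\<bar> \<le> B * bump x ^ j"
proof -
  obtain g :: "'a \<Rightarrow> real" where g: "smooth g"
    "(neg_laplacian ^^ m) (\<lambda>x. bump x ^ (j + 2 * m) * bump x ^ (l - (j + 2 * m))) = (\<lambda>x. bump x ^ j * g x)"
    using neg_laplacian_pow_power_mult[OF smooth_bump smooth_power[OF smooth_bump]] by blast
  have "(\<lambda>x::'a. bump x ^ (j + 2 * m) * bump x ^ (l - (j + 2 * m))) = (\<lambda>x. bump x ^ l)"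
    using assms by (simp add: power_add[symmetric])
  with g bump_power_mult_bound[OF g(1) assms(1)] that show ?thesis by metis
qed

lemma deriv_bump_bound:
  assumes "0 < j" "j + 2 \<le> l"
  obtains B where "0 \<le> B" "\<And>t::real. \<bar>deriv (\<lambda>t. bump t ^ l) t\<bar> \<le> B * bump t ^ j"
    "\<And>t::real. \<bar>deriv (deriv (\<lambda>t. bump t ^ l)) t\<bar> \<le> B * bump t ^ j"
proof -
  let ?i = "l - Suc (Suc j)"
  have "bump t ^ Suc (Suc j) * bump t ^ ?i = bump t ^ l" for t :: real
    using assms le_add_diff_inverse[of "Suc (Suc j)" l] by (simp only: power_add[symmetric])
  then have eq: "(\<lambda>t::real. bump t ^ Suc (Suc j) * bump t ^ ?i) = (\<lambda>t. bump t ^ l)"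
    by (rule ext)
  obtain g1 :: "real \<Rightarrow> real" where g1: "smooth g1"
    "partial_deriv 1 (\<lambda>t. bump t ^ Suc (Suc j) * bump t ^ ?i) = (\<lambda>t. bump t ^ Suc j * g1 t)"
    by (rule partial_deriv_power_mult[OF smooth_bump smooth_power[OF smooth_bump], of "1::real" "Suc j" ?i]) auto
  obtain g2 :: "real \<Rightarrow> real" where g2: "smooth g2"
    "partial_deriv 1 (\<lambda>t. bump t ^ Suc j * g1 t) = (\<lambda>t. bump t ^ j * g2 t)"
    by (rule partial_deriv_power_mult[OF smooth_bump g1(1), of "1::real" j]) auto
  have d1: "deriv (\<lambda>t. bump t ^ l) = (\<lambda>t. bump t ^ Suc j * g1 t)"
    using g1(2) by (simp only: eq deriv_eq_partial_deriv)
  have d2: "deriv (deriv (\<lambda>t. bump t ^ l)) = (\<lambda>t. bump t ^ j * g2 t)"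
    using g2(2) by (simp only: d1 deriv_eq_partial_deriv)
  obtain B1 where B1: "0 \<le> B1" "\<And>t. \<bar>bump t ^ j * (bump t * g1 t)\<bar> \<le> B1 * bump t ^ j"
    using bump_power_mult_bound[OF smooth_mult[OF smooth_bump g1(1)] assms(1)] by blast
  obtain B2 where B2: "0 \<le> B2" "\<And>t. \<bar>bump t ^ j * g2 t\<bar> \<le> B2 * bump t ^ j"
    using bump_power_mult_bound[OF g2(1) assms(1)] by blast
  have le: "B1 * bump t ^ j \<le> max B1 B2 * bump t ^ j" "B2 * bump t ^ j \<le> max B1 B2 * bump t ^ j" for t :: real
    by (auto intro: mult_right_mono)
  show ?thesis
  proof (rule that)
    show "0 \<le> max B1 B2" using B1 by simp
    show "\<bar>deriv (\<lambda>t. bump t ^ l) t\<bar> \<le> max B1 B2 * bump t ^ j" for t :: real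
      using order_trans[OF B1(2) le(1), of t] unfolding d1 power_Suc2 mult.assoc .
    show "\<bar>deriv (deriv (\<lambda>t. bump t ^ l)) t\<bar> \<le> max B1 B2 * bump t ^ j" for t :: real
      using order_trans[OF B2(2) le(2), of t] unfolding d2 .
  qed
qed

lemma partial_deriv_0_of_locally_const:
  assumes "open S" "\<And>x. x \<in> S \<Longrightarrow> f x = c" "x \<in> S"
  shows "partial_deriv b f x = 0"
proof (rule partial_deriv_eqI)
  have "open ((\<lambda>s. x + s *\<^sub>R b) -` S)"
    by (intro open_vimage assms continuous_intros)
  then show "((\<lambda>s. f (x + s *\<^sub>R b)) has_real_derivative 0) (at 0)"
    by (rule has_field_derivative_transform_within_open[OF DERIV_const]) (use assms in auto)
qed

lemma neg_laplacian_pow_0_of_locally_const: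
  assumes "open S" "\<And>x. x \<in> S \<Longrightarrow> f x = c" "x \<in> S" "0 < m"
  shows "(neg_laplacian ^^ m) f x = 0"
proof -
  have "\<forall>x\<in>S. (neg_laplacian ^^ Suc k) f x = 0" for k
  proof (induction k)
    case 0
    have "partial_deriv b (partial_deriv b f) x = 0" if "x \<in> S" for b x
      using partial_deriv_0_of_locally_const[OF assms(1)] assms(2) that by meson
    then show ?case by (simp add: neg_laplacian_def)
  next
    case (Suc k)
    have "partial_deriv b (partial_deriv b ((neg_laplacian ^^ Suc k) f)) x = 0" if "x \<in> S" for b x
      using partial_deriv_0_of_locally_const[OF assms(1)] Suc that by meson
    then show ?case
      unfolding funpow.simps(2)[of "Suc k"] o_apply neg_laplacian_def[of "(neg_laplacian ^^ Suc k) f"] by simp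
  qed
  then show ?thesis using assms(3,4) by (metis Suc_pred)
qed

section \<open>Young's inequality and integrability\<close>

text \<open>The two summands bound the two cases \<open>y \<le> c x powr (s - 1)\<close> and \<open>y > c x powr (s - 1)\<close>, so no constant
  is needed.\<close>

lemma Young_weighted:
  fixes x y c s :: real
  assumes "0 \<le> x" "0 \<le> y" "0 < c" "1 < s"
  shows "x * y \<le> c * x powr s + c powr (- 1 / (s - 1)) * y powr (s / (s - 1))"
proof (cases "y \<le> c * x powr (s - 1)")
  case True
  have "x * y \<le> x * (c * x powr (s - 1))"
    using True assms by (intro mult_left_mono) auto
  also have "\<dots> = c * x powr s"
    using assms by (cases "x = 0") (auto simp: powr_diff)
  finally show ?thesis
    by (rule order_trans) simp
next
  case False
  then have "c * x powr (s - 1) < y" by simp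
  moreover have "0 \<le> c * x powr (s - 1)" using assms by simp
  ultimately have y: "0 < y" "x powr (s - 1) < y / c"
    using assms by (linarith, simp add: pos_less_divide_eq mult.commute)
  have "x = (x powr (s - 1)) powr (1 / (s - 1))"
    using assms by (simp add: powr_powr)
  also have "\<dots> \<le> (y / c) powr (1 / (s - 1))"
    using y assms by (intro powr_mono2) auto
  also have "\<dots> = c powr (- 1 / (s - 1)) * y powr (1 / (s - 1))"
    using y assms by (simp add: powr_divide powr_minus_divide)
  finally have "x * y \<le> c powr (- 1 / (s - 1)) * y powr (1 / (s - 1)) * y"
    using y by (intro mult_right_mono) auto
  also have "\<dots> = c powr (- 1 / (s - 1)) * y powr (s / (s - 1))"
  proof -
    have "s / (s - 1) = 1 / (s - 1) + 1" using assms by (simp add: field_simps)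
    then show ?thesis using y by (simp add: powr_add)
  qed
  finally show ?thesis
    by (rule order_trans) (use assms in simp)
qed

lemma set_integrable_continuous_mult:
  fixes f g :: "'a::euclidean_space \<Rightarrow> real"
  assumes "set_integrable lebesgue K f" "compact K" "continuous_on UNIV g"
  shows "set_integrable lebesgue K (\<lambda>x. f x * g x)"
proof -
  have "K \<in> sets lebesgue" using assms(2) by (simp add: lmeasurable_compact fmeasurableD)
  moreover have "continuous_on K g" by (rule continuous_on_subset[OF assms(3) subset_UNIV])
  ultimately have "g \<in> borel_measurable (lebesgue_on K)" "bounded (g ` K)"
    by (simp_all add: continuous_imp_measurable_on_sets_lebesgue compact_imp_bounded
        compact_continuous_image assms(2))
  then have "(\<lambda>x. g x * f x) absolutely_integrable_on K"
    using absolutely_integrable_bounded_measurable_product[OF bilinear_times _ \<open>K \<in> sets lebesgue\<close> _ assms(1)]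
    by blast
  then show ?thesis by (simp add: mult.commute)
qed

lemma integrable_of_set_integrable:
  fixes f :: "'a::euclidean_space \<Rightarrow> real"
  assumes "set_integrable lebesgue K f" "\<And>x. x \<notin> K \<Longrightarrow> f x = 0"
  shows "integrable lebesgue f"
proof -
  have "(\<lambda>x. indicator K x *\<^sub>R f x) = f" using assms(2) by (force simp: indicator_def)
  then show ?thesis using assms(1) by (simp add: set_integrable_def)
qed

section \<open>Pairing the data with cutoffs\<close>

lemma sum_indicator_levels:
  assumes "0 \<le> c" "c \<le> 1"
  shows "(\<Sum>i=1..k. if real i / real k \<le> c then 1 else 0 :: real) = \<lfloor>real k * c\<rfloor>"
proof (cases "k = 0")
  case False
  define n where "n = nat \<lfloor>real k * c\<rfloor>"
  have "real k * c \<le> real k" using assms by (simp add: mult_left_le)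
  then have "n \<le> k"
    by (simp add: n_def nat_le_iff floor_le_iff)
  have iff: "real i / real k \<le> c \<longleftrightarrow> i \<le> n" for i
    using False assms by (simp add: n_def pos_divide_le_eq le_nat_iff le_floor_iff mult.commute)
  have "{i \<in> {1..k}. real i / real k \<le> c} = {1..n}"
    unfolding iff using \<open>n \<le> k\<close> by auto
  moreover have "(\<Sum>i=1..k. if real i / real k \<le> c then 1 else 0 :: real) = card {i \<in> {1..k}. real i / real k \<le> c}"
    by (simp add: sum.If_cases Int_def)
  ultimately show ?thesis using assms by (simp add: n_def)
qed simp

text \<open>A discrete layer cake: \<open>\<theta>\<close> differs by at most \<open>1/k\<close> from the average of the indicators of its superlevel
  sets at the heights \<open>1/k, ..., k/k\<close>. These sets are balls of radius at least \<open>R\<close>, and over each of them the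
  integral of \<open>f\<close> is at least \<open>m\<close>. Local integrability of \<open>f\<close> makes the error vanish as \<open>k \<rightarrow> \<infinity>\<close>. An
  argument with dominated convergence would need \<open>f\<close> integrable on the whole space, which the data
  \<open>u\<^sub>1 + (-\<Delta>)\<^sup>\<delta> u\<^sub>0\<close> need not be.\<close>

lemma integral_mult_ge_of_ball_superlevels:
  fixes f \<theta> :: "'a::euclidean_space \<Rightarrow> real"
  assumes loc: "\<And>\<rho>. set_integrable lebesgue (cball 0 \<rho>) f"
    and ge: "\<And>\<rho>. R \<le> \<rho> \<Longrightarrow> m \<le> (LINT x:cball 0 \<rho>|lebesgue. f x)"
    and \<theta>: "continuous_on UNIV \<theta>" "\<And>x. 0 \<le> \<theta> x" "\<And>x. \<theta> x \<le> 1" "\<And>x. x \<notin> cball 0 L \<Longrightarrow> \<theta> x = 0"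
    and lev: "\<And>c. 0 < c \<Longrightarrow> c \<le> 1 \<Longrightarrow> \<exists>\<rho>\<ge>R. {x. c \<le> \<theta> x} = cball 0 \<rho>"
  shows "m \<le> (LINT x|lebesgue. f x * \<theta> x)"
proof -
  define M where "M = (LINT x:cball 0 L|lebesgue. \<bar>f x\<bar>)"
  have f\<theta>: "integrable lebesgue (\<lambda>x. f x * \<theta> x)"
    by (rule integrable_of_set_integrable[OF set_integrable_continuous_mult[OF loc[of L]]])
       (auto simp: \<theta>)
  have *: "m - M / real k \<le> (LINT x|lebesgue. f x * \<theta> x)" if "0 < k" for k :: nat
  proof -
    have "\<exists>\<rho>. R \<le> \<rho> \<and> {x. real i / real k \<le> \<theta> x} = cball 0 \<rho>" if "i \<in> {1..k}" for i
      using lev[of "real i / real k"] that by auto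
    then obtain \<rho> where \<rho>: "\<And>i. i \<in> {1..k} \<Longrightarrow> R \<le> \<rho> i"
      "\<And>i. i \<in> {1..k} \<Longrightarrow> {x. real i / real k \<le> \<theta> x} = cball 0 (\<rho> i)" by metis
    define N where "N x = (\<Sum>i=1..k. indicator (cball 0 (\<rho> i)) x :: real)" for x :: 'a
    have N: "N x = \<lfloor>real k * \<theta> x\<rfloor>" for x
    proof -
      have "N x = (\<Sum>i=1..k. if real i / real k \<le> \<theta> x then 1 else 0)"
        unfolding N_def
      proof (rule sum.cong[OF refl])
        fix i assume "i \<in> {1..k}"
        then have "x \<in> cball 0 (\<rho> i) \<longleftrightarrow> real i / real k \<le> \<theta> x" using \<rho>(2) by blast
        then show "indicator (cball 0 (\<rho> i)) x = (if real i / real k \<le> \<theta> x then 1 else 0 :: real)"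
          unfolding indicator_def by simp
      qed
      then show ?thesis using sum_indicator_levels \<theta> by metis
    qed
    have intN: "integrable lebesgue (\<lambda>x. f x * N x)" and
      valN: "(LINT x|lebesgue. f x * N x) = (\<Sum>i=1..k. LINT x:cball 0 (\<rho> i)|lebesgue. f x)"
    proof -
      have eq: "f x * N x = (\<Sum>i=1..k. indicator (cball 0 (\<rho> i)) x *\<^sub>R f x)" for x
        unfolding N_def by (simp add: sum_distrib_left mult.commute)
      show "integrable lebesgue (\<lambda>x. f x * N x)"
        unfolding eq using loc by (intro Bochner_Integration.integrable_sum) (simp add: set_integrable_def)
      show "(LINT x|lebesgue. f x * N x) = (\<Sum>i=1..k. LINT x:cball 0 (\<rho> i)|lebesgue. f x)"
        unfolding eq set_lebesgue_integral_def using loc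
        by (intro Bochner_Integration.integral_sum) (simp add: set_integrable_def)
    qed
    have intM: "integrable lebesgue (\<lambda>x. indicator (cball 0 L) x *\<^sub>R \<bar>f x\<bar>)"
      using set_integrable_abs[OF loc[of L]] by (simp add: set_integrable_def)
    have pt: "(f x * N x - indicator (cball 0 L) x *\<^sub>R \<bar>f x\<bar>) / real k \<le> f x * \<theta> x" for x
    proof (cases "x \<in> cball 0 L")
      case True
      have "\<bar>real k * \<theta> x - N x\<bar> \<le> 1" unfolding N by linarith
      then have "\<bar>f x\<bar> * \<bar>N x - real k * \<theta> x\<bar> \<le> \<bar>f x\<bar> * 1"
        by (intro mult_left_mono) auto
      then have "f x * N x - real k * (f x * \<theta> x) \<le> \<bar>f x\<bar>"
        by (simp add: abs_mult[symmetric] algebra_simps)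
      then show ?thesis using True that by (simp add: field_simps)
    next
      case False
      then show ?thesis using \<theta>(4)[of x] by (simp add: N)
    qed
    have "real k * m \<le> (LINT x|lebesgue. f x * N x)"
      unfolding valN using sum_bounded_below[of "{1..k}" m "\<lambda>i. LINT x:cball 0 (\<rho> i)|lebesgue. f x"] ge \<rho>(1) by simp
    then have "m - M / real k \<le> ((LINT x|lebesgue. f x * N x) - M) / real k"
      using that by (simp add: field_simps)
    also have "\<dots> = (LINT x|lebesgue. (f x * N x - indicator (cball 0 L) x *\<^sub>R \<bar>f x\<bar>) / real k)"
      using intN intM by (simp add: M_def set_lebesgue_integral_def)
    also have "\<dots> \<le> (LINT x|lebesgue. f x * \<theta> x)"
      using intN intM f\<theta> pt by (intro integral_mono) auto
    finally show ?thesis .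
  qed
  have "(\<lambda>k. m - M / real k) \<longlonglongrightarrow> m - 0"
    by (intro tendsto_diff tendsto_const lim_const_over_n)
  then have "(\<lambda>k. m - M / real k) \<longlonglongrightarrow> m" by simp
  then show ?thesis
    by (rule LIMSEQ_le_const2) (use * in \<open>auto intro!: exI[of _ 1]\<close>)
qed

definition dilated_bump :: "nat \<Rightarrow> real \<Rightarrow> 'a::euclidean_space \<Rightarrow> real" where
  "dilated_bump l R x = bump ((1 / R) *\<^sub>R x) ^ l"

lemma smooth_bump_power: "smooth (\<lambda>x. bump x ^ l)"
  by (intro smooth_power smooth_bump)

lemma smooth_dilated_bump: "smooth (dilated_bump l R)"
  unfolding dilated_bump_def[abs_def] by (intro smooth_power smooth_scale smooth_bump)

lemma dilated_bump_eq_0: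
  assumes "0 < l" "0 < R" "2 * R \<le> norm x"
  shows "dilated_bump l R x = 0"
  using assms by (simp add: dilated_bump_def bump_eq_0 field_simps zero_power)

lemma dilated_bump_eq_1:
  assumes "0 < R" "norm x \<le> R"
  shows "dilated_bump l R x = 1"
proof -
  have "norm ((1 / R) *\<^sub>R x) \<le> 1" using assms by (simp add: field_simps)
  then have "(norm ((1 / R) *\<^sub>R x))\<^sup>2 \<le> 1\<^sup>2" by (rule power_mono) simp
  then show ?thesis by (simp add: dilated_bump_def bump_eq_1)
qed

lemma dilated_bump_nonneg [simp]: "0 \<le> dilated_bump l R x" by (simp add: dilated_bump_def)
lemma dilated_bump_le_1 [simp]: "dilated_bump l R x \<le> 1" by (simp add: dilated_bump_def power_le_one)

lemma test_functionsI:
  assumes "smooth f" "compact K" "K \<subseteq> U" "\<And>x. x \<notin> K \<Longrightarrow> f x = 0"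
  shows "f \<in> test_functions U"
proof -
  have "closure {x. f x \<noteq> 0} \<subseteq> K"
    using assms by (intro closure_minimal) (auto simp: compact_imp_closed)
  moreover have "compact (closure {x. f x \<noteq> 0})"
    unfolding compact_closure by (rule bounded_subset[OF compact_imp_bounded[OF assms(2)]]) (use assms(4) in blast)
  ultimately show ?thesis
    using assms(1,3) unfolding test_functions_def by blast
qed

lemma dilated_bump_test_function:
  assumes "0 < l" "0 < R"
  shows "dilated_bump l R \<in> test_functions UNIV"
  by (rule test_functionsI[OF smooth_dilated_bump, of "cball 0 (2 * R)"])
     (use assms in \<open>auto simp: dilated_bump_eq_0\<close>)

lemma integral_dilated_bump_ge:
  fixes f :: "'a::euclidean_space \<Rightarrow> real"
  assumes "\<And>\<rho>. set_integrable lebesgue (cball 0 \<rho>) f"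
    and "\<And>\<rho>. R \<le> \<rho> \<Longrightarrow> m \<le> (LINT x:cball 0 \<rho>|lebesgue. f x)"
    and "0 < R" "0 < l"
  shows "m \<le> (LINT x|lebesgue. f x * dilated_bump l R x)"
proof (rule integral_mult_ge_of_ball_superlevels[OF assms(1,2)])
  show "\<exists>\<rho>\<ge>R. {x::'a. c \<le> dilated_bump l R x} = cball 0 \<rho>" if c: "0 < c" "c \<le> 1" for c
  proof -
    obtain r where r: "1 \<le> r" "{x::'a. c \<le> bump x ^ l} = cball 0 r"
      using bump_superlevel_ball[OF c assms(4)] by blast
    then have "c \<le> bump x ^ l \<longleftrightarrow> norm x \<le> r" for x :: 'a by (auto simp: set_eq_iff)
    then have "{x::'a. c \<le> dilated_bump l R x} = cball 0 (R * r)"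
      using assms(3) by (auto simp: dilated_bump_def field_simps)
    then show ?thesis using r assms by (intro exI[of _ "R * r"]) simp
  qed
  show "dilated_bump l R x = 0" if "x \<notin> cball 0 (2 * R)" for x :: 'a
    using that assms dilated_bump_eq_0[of l R x] by simp
qed (simp_all add: smooth_continuous smooth_dilated_bump)

lemma local_L1_set_integrable:
  fixes f :: "'a::euclidean_space \<Rightarrow> real"
  assumes "f \<in> local_Lp 1 UNIV" "compact K"
  shows "set_integrable lebesgue K f"
proof -
  have K: "K \<in> sets lebesgue" using assms(2) by (simp add: lmeasurable_compact fmeasurableD)
  have "f \<in> borel_measurable (lebesgue_on K)" "integrable (lebesgue_on K) (\<lambda>x. norm (f x) powr 1)"
    using assms unfolding local_Lp_def Lp_def by blast+
  then have "integrable (lebesgue_on K) f"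
    using integrable_norm_iff[of f "lebesgue_on K"] by simp
  then show ?thesis using K by (simp add: integrable_restrict_space set_integrable_def)
qed

lemma L1_subset_local_L1:
  fixes f :: "'a::euclidean_space \<Rightarrow> real"
  assumes "f \<in> Lp 1 UNIV"
  shows "f \<in> local_Lp 1 UNIV"
proof -
  have f: "integrable lebesgue (\<lambda>x. \<bar>f x\<bar>)" "f \<in> borel_measurable lebesgue"
    using assms by (auto simp: Lp_def lebesgue_on_UNIV_eq)
  have "integrable (lebesgue_on K) (\<lambda>x. \<bar>f x\<bar>)" if "compact K" for K
    using f that
    by (simp add: integrable_restrict_space lmeasurable_compact fmeasurableD integrable_mult_indicator del: real_scaleR_def)
  then show ?thesis
    using f by (auto simp: local_Lp_def Lp_def intro: measurable_restrict_space1)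
qed

lemma integrable_mult_test_function:
  fixes f :: "'a::euclidean_space \<Rightarrow> real"
  assumes "f \<in> local_Lp 1 UNIV" "\<psi> \<in> test_functions UNIV"
  shows "integrable lebesgue (\<lambda>x. f x * \<psi> x)"
proof (rule integrable_of_set_integrable)
  let ?K = "closure {x. \<psi> x \<noteq> 0}"
  show "set_integrable lebesgue ?K (\<lambda>x. f x * \<psi> x)"
    using assms by (intro set_integrable_continuous_mult local_L1_set_integrable)
      (auto simp: test_functions_def smooth_continuous)
  show "f x * \<psi> x = 0" if "x \<notin> ?K" for x
  proof -
    have "x \<notin> {x. \<psi> x \<noteq> 0}" by (rule contra_subsetD[OF closure_subset that])
    then show ?thesis by simp
  qed
qed

text \<open>The pairing of \<open>u\<^sub>1 + (-\<Delta>)\<^sup>\<delta> u\<^sub>0\<close> with \<open>\<psi>\<close>, with the operator moved to \<open>\<psi>\<close>. In this form it does not depend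
  on the function chosen to represent \<open>(-\<Delta>)\<^sup>\<delta> u\<^sub>0\<close>, which may differ between the weak equation and the
  positivity assumption, and it is visibly linear in the data.\<close>

definition data_pairing :: "nat \<Rightarrow> ('a::euclidean_space \<Rightarrow> real) \<Rightarrow> ('a \<Rightarrow> real) \<Rightarrow> ('a \<Rightarrow> real) \<Rightarrow> real" where
  "data_pairing \<delta> u\<^sub>0 u\<^sub>1 \<psi> = (LINT x|lebesgue. u\<^sub>1 x * \<psi> x) + (LINT x|lebesgue. u\<^sub>0 x * (neg_laplacian ^^ \<delta>) \<psi> x)"

lemma data_pairing_scale: "data_pairing \<delta> (\<lambda>x. \<epsilon> * u\<^sub>0 x) (\<lambda>x. \<epsilon> * u\<^sub>1 x) \<psi> = \<epsilon> * data_pairing \<delta> u\<^sub>0 u\<^sub>1 \<psi>"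
  by (simp add: data_pairing_def mult.assoc distrib_left)

lemma integral_data_eq_pairing:
  assumes "u\<^sub>1 \<in> Lp 1 UNIV" "has_neg_laplacian_pow \<delta> u\<^sub>0 w" "\<psi> \<in> test_functions UNIV"
  shows "(LINT x|lebesgue. (u\<^sub>1 x + w x) * \<psi> x) = data_pairing \<delta> u\<^sub>0 u\<^sub>1 \<psi>"
proof -
  have "integrable lebesgue (\<lambda>x. u\<^sub>1 x * \<psi> x)" "integrable lebesgue (\<lambda>x. w x * \<psi> x)"
    using assms by (auto intro!: integrable_mult_test_function L1_subset_local_L1 simp: has_neg_laplacian_pow_def)
  then show ?thesis
    using assms(2,3) by (simp add: has_neg_laplacian_pow_def data_pairing_def distrib_right)
qed

lemma positive_mass_pairing:
  fixes u\<^sub>0 u\<^sub>1 :: "'a::euclidean_space \<Rightarrow> real"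
  assumes "positive_mass \<delta> u\<^sub>0 u\<^sub>1" "u\<^sub>1 \<in> Lp 1 UNIV" "0 < l"
  obtains m R\<^sub>0 where "0 < m" "1 \<le> R\<^sub>0" "\<And>R. R\<^sub>0 \<le> R \<Longrightarrow> m \<le> data_pairing \<delta> u\<^sub>0 u\<^sub>1 (dilated_bump l R)"
proof -
  obtain w where w: "has_neg_laplacian_pow \<delta> u\<^sub>0 w"
    and lim: "Liminf at_top (\<lambda>R. ereal (LINT x|lebesgue_on (cball 0 R). u\<^sub>1 x + w x)) > 0"
    using assms(1) by (auto simp: positive_mass_def)
  obtain m where m: "0 < m" "ereal m < Liminf at_top (\<lambda>R. ereal (LINT x|lebesgue_on (cball 0 R). u\<^sub>1 x + w x))"
    using ereal_dense2[OF lim] by auto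
  from less_LiminfD[OF m(2)] obtain R1 where
    R1: "\<And>R. R1 \<le> R \<Longrightarrow> m < (LINT x|lebesgue_on (cball 0 R). u\<^sub>1 x + w x)"
    by (auto simp: eventually_at_top_linorder)
  have loc: "set_integrable lebesgue (cball 0 \<rho>) (\<lambda>x. u\<^sub>1 x + w x)" for \<rho>
    using w unfolding has_neg_laplacian_pow_def
    by (intro set_integral_add local_L1_set_integrable L1_subset_local_L1[OF assms(2)] compact_cball) blast
  have "(LINT x:cball 0 R|lebesgue. u\<^sub>1 x + w x) = (LINT x|lebesgue_on (cball 0 R). u\<^sub>1 x + w x)" for R
    by (simp add: integral_restrict_space set_lebesgue_integral_def)
  then have ge: "m \<le> (LINT x:cball 0 R|lebesgue. u\<^sub>1 x + w x)" if "R1 \<le> R" for R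
    using R1[OF that] by simp
  have "m \<le> data_pairing \<delta> u\<^sub>0 u\<^sub>1 (dilated_bump l R)" if R: "max 1 R1 \<le> R" for R
  proof -
    have "m \<le> (LINT x|lebesgue. (u\<^sub>1 x + w x) * dilated_bump l R x)"
      by (rule integral_dilated_bump_ge[OF loc, of R]) (use R ge assms(3) in auto)
    also have "\<dots> = data_pairing \<delta> u\<^sub>0 u\<^sub>1 (dilated_bump l R)"
      by (rule integral_data_eq_pairing[OF assms(2) w dilated_bump_test_function]) (use R assms(3) in auto)
    finally show ?thesis .
  qed
  then show ?thesis using that[of m "max 1 R1"] m(1) by simp
qed

section \<open>Parabolic cutoffs and the adjoint operator\<close>

lemma time_deriv_product:
  assumes "smooth f"
  shows "time_deriv (\<lambda>(t, x). f t * g x) = (\<lambda>(t, x). deriv f t * g x)"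
proof -
  have "deriv (\<lambda>s. f s * g x) t = deriv f t * g x" for t x
  proof -
    have "(f has_real_derivative deriv f t) (at t)"
      using smooth_differentiable[OF assms, of t] by (simp add: DERIV_deriv_iff_real_differentiable)
    then have "((\<lambda>s. f s * g x) has_real_derivative deriv f t * g x) (at t)"
      by (rule DERIV_cmult_right)
    then show ?thesis by (rule DERIV_imp_deriv)
  qed
  then show ?thesis by (simp add: time_deriv_def case_prod_beta')
qed

lemma space_neg_laplacian_pow_product:
  assumes "smooth g"
  shows "space_neg_laplacian_pow m (\<lambda>(t, x). f t * g x) = (\<lambda>(t, x). f t * (neg_laplacian ^^ m) g x)"
proof -
  have "(neg_laplacian ^^ m) (\<lambda>y. c * g y) x = c * (neg_laplacian ^^ m) g x" for c x
    using fun_cong[OF neg_laplacian_pow_scale[OF assms, of m c 1], of x] by simp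
  then show ?thesis by (simp add: space_neg_laplacian_pow_def case_prod_beta')
qed

lemma smooth_deriv: "smooth f \<Longrightarrow> smooth (deriv f)" for f :: "real \<Rightarrow> real"
  unfolding deriv_eq_partial_deriv by (rule smooth_partial_deriv) simp_all

lemma deriv_scale:
  fixes f :: "real \<Rightarrow> real"
  assumes "smooth f"
  shows "deriv (\<lambda>t. a * f (c *\<^sub>R t)) = (\<lambda>t. a * c * deriv f (c *\<^sub>R t))"
  unfolding deriv_eq_partial_deriv by (rule partial_deriv_scale[OF assms])

lemma deriv_dilated_bump:
  "deriv (dilated_bump l S) = (\<lambda>t. (1 / S) * deriv (\<lambda>t. bump t ^ l) ((1 / S) *\<^sub>R t))"
  "deriv (deriv (dilated_bump l S)) = (\<lambda>t. (1 / S)\<^sup>2 * deriv (deriv (\<lambda>t. bump t ^ l)) ((1 / S) *\<^sub>R t))"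
proof -
  show 1: "deriv (dilated_bump l S) = (\<lambda>t. (1 / S) * deriv (\<lambda>t. bump t ^ l) ((1 / S) *\<^sub>R t))"
    using deriv_scale[OF smooth_bump_power[of l], where a = 1 and c = "1 / S"] by (simp add: dilated_bump_def[abs_def])
  show "deriv (deriv (dilated_bump l S)) = (\<lambda>t. (1 / S)\<^sup>2 * deriv (deriv (\<lambda>t. bump t ^ l)) ((1 / S) *\<^sub>R t))"
    unfolding 1 deriv_scale[OF smooth_deriv[OF smooth_bump_power]] power2_eq_square ..
qed

lemma neg_laplacian_pow_dilated_bump:
  "(neg_laplacian ^^ m) (dilated_bump l R) =
    (\<lambda>x. (1 / R) ^ (2 * m) * (neg_laplacian ^^ m) (\<lambda>x. bump x ^ l) ((1 / R) *\<^sub>R x))"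
  using neg_laplacian_pow_scale[OF smooth_bump_power[of l], where a = 1 and c = "1 / R" and m = m]
  by (simp add: dilated_bump_def[abs_def])

definition parabolic_test :: "nat \<Rightarrow> nat \<Rightarrow> real \<Rightarrow> real \<times> 'a::euclidean_space \<Rightarrow> real" where
  "parabolic_test a l R = (\<lambda>(t, x). dilated_bump l (R ^ a) t * dilated_bump l R x)"

definition parabolic_box :: "nat \<Rightarrow> real \<Rightarrow> (real \<times> 'a::euclidean_space) set" where
  "parabolic_box a R = {0..R ^ a} \<times> cball 0 R"

definition adjoint_op :: "nat \<Rightarrow> nat \<Rightarrow> (real \<times> 'a::euclidean_space \<Rightarrow> real) \<Rightarrow> real \<times> 'a \<Rightarrow> real" where
  "adjoint_op \<sigma> \<delta> \<phi> z = time_deriv (time_deriv \<phi>) z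
     - space_neg_laplacian_pow \<delta> (time_deriv \<phi>) z + space_neg_laplacian_pow \<sigma> \<phi> z"

lemma adjoint_op_product:
  assumes "smooth f" "smooth g"
  shows "adjoint_op \<sigma> \<delta> (\<lambda>(t, x). f t * g x) (t, x) =
    deriv (deriv f) t * g x - deriv f t * (neg_laplacian ^^ \<delta>) g x + f t * (neg_laplacian ^^ \<sigma>) g x"
  unfolding adjoint_op_def time_deriv_product[OF assms(1)] time_deriv_product[OF smooth_deriv[OF assms(1)]]
    space_neg_laplacian_pow_product[OF assms(2)] by simp

lemma compact_parabolic_box: "compact (parabolic_box a R)"
  unfolding parabolic_box_def by (intro compact_Times compact_Icc compact_cball)

lemma parabolic_box_subset: "1 \<le> R \<Longrightarrow> parabolic_box a R \<subseteq> parabolic_box a (2 * R)"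
  using power_mono[of R "2 * R" a] order_trans[of _ "R ^ a" "(2 * R) ^ a"]
  unfolding parabolic_box_def by (intro Sigma_mono) auto

lemma measure_parabolic_box:
  assumes "0 \<le> R"
  shows "measure lebesgue (parabolic_box a R :: (real \<times> 'a::euclidean_space) set)
    = unit_ball_vol (DIM('a)) * R ^ (a + DIM('a))"
proof -
  have "emeasure lborel (parabolic_box a R :: (real \<times> 'a) set) = emeasure lborel {0..R ^ a} * emeasure lborel (cball 0 R :: 'a set)"
    unfolding parabolic_box_def lborel_prod[symmetric]
    by (rule lborel.emeasure_pair_measure_Times) auto
  then have "emeasure lborel (parabolic_box a R :: (real \<times> 'a) set) = ennreal (R ^ a * (unit_ball_vol (DIM('a)) * R ^ DIM('a)))"
    using assms by (simp add: emeasure_cball ennreal_mult)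
  moreover have "parabolic_box a R \<in> sets (lborel :: (real \<times> 'a) measure)"
    using compact_imp_closed[OF compact_parabolic_box[of a R, where 'a='a]] by simp
  ultimately show ?thesis
    using assms by (simp add: measure_def power_add mult_ac)
qed

lemma parabolic_test_nonneg [simp]: "0 \<le> parabolic_test a l R z"
  by (simp add: parabolic_test_def case_prod_beta')

lemma parabolic_test_le_1 [simp]: "parabolic_test a l R z \<le> 1"
  by (simp add: parabolic_test_def case_prod_beta' mult_le_one)

lemma parabolic_test_eq_1:
  assumes "1 \<le> R" "z \<in> parabolic_box a R"
  shows "parabolic_test a l R z = 1"
  using assms by (auto simp: parabolic_test_def parabolic_box_def dilated_bump_eq_1)

lemma smooth_parabolic_test: "smooth (parabolic_test a l R :: real \<times> 'a::euclidean_space \<Rightarrow> real)"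
proof -
  have fst: "smooth (\<lambda>z :: real \<times> 'a. dilated_bump l (R ^ a) (fst z))"
    by (rule smooth_compose[OF smooth_dilated_bump smooth_bounded_linear[OF bounded_linear_fst]])
  have "smooth (\<lambda>z :: real \<times> 'a. transition ((\<Sum>b\<in>Basis. (((1 / R) *\<^sub>R snd z) \<bullet> b) * (((1 / R) *\<^sub>R snd z) \<bullet> b)) * (1/2)))"
    by (intro smooth_compose[OF smooth_transition] smooth_mult smooth_const smooth_sum
        smooth_bounded_linear bounded_linear_inner_left_comp bounded_linear_scaleR_right
        bounded_linear_compose[OF bounded_linear_scaleR_right bounded_linear_snd] finite_Basis)
  moreover have "(\<Sum>b\<in>Basis. (x \<bullet> b) * (x \<bullet> b)) = (norm x)\<^sup>2" for x :: 'a
    by (simp add: euclidean_inner[of x x, symmetric] power2_norm_eq_inner)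
  ultimately have "smooth (\<lambda>z :: real \<times> 'a. bump ((1 / R) *\<^sub>R snd z))"
    by (simp only: bump_def) simp
  from smooth_mult[OF fst smooth_power[OF this, of l]] show ?thesis
    by (simp add: parabolic_test_def dilated_bump_def case_prod_beta')
qed

lemma parabolic_test_test_function:
  assumes "1 \<le> R" "0 < l" "ereal (2 * R ^ a) < T"
  shows "parabolic_test a l R \<in> test_functions ({t. ereal t < T} \<times> UNIV)"
proof (rule test_functionsI[OF smooth_parabolic_test, of "{- (2 * R ^ a)..2 * R ^ a} \<times> cball 0 (2 * R)"])
  show "compact ({- (2 * R ^ a)..2 * R ^ a} \<times> cball (0::'a) (2 * R))"
    by (intro compact_Times compact_Icc compact_cball)
  have "ereal t < T" if "t \<le> 2 * R ^ a" for t
    using that assms(3) by (meson ereal_less_eq(3) le_less_trans)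
  then show "{- (2 * R ^ a)..2 * R ^ a} \<times> cball (0::'a) (2 * R) \<subseteq> {t. ereal t < T} \<times> UNIV"
    by auto
  show "parabolic_test a l R z = 0" if "z \<notin> {- (2 * R ^ a)..2 * R ^ a} \<times> cball (0::'a) (2 * R)" for z :: "real \<times> 'a"
  proof -
    obtain t x where z: "z = (t, x)" by (cases z)
    have "2 * R ^ a \<le> norm t \<or> 2 * R \<le> norm x" using that z by auto
    then show ?thesis
      using assms dilated_bump_eq_0[of l "R ^ a" t] dilated_bump_eq_0[of l R x] by (auto simp: z parabolic_test_def)
  qed
qed

text \<open>Each of the three terms is a power of \<open>1/R\<close> times a function of the rescaled variables
  \<open>(t/R\<^sup>a, x/R)\<close>.\<close>

lemma adjoint_op_parabolic_test:
  "adjoint_op \<sigma> \<delta> (parabolic_test a l R) (t, x) =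
     (1 / R ^ a)\<^sup>2 * deriv (deriv (\<lambda>t. bump t ^ l)) ((1 / R ^ a) *\<^sub>R t) * bump ((1 / R) *\<^sub>R x) ^ l
   - (1 / R ^ a) * deriv (\<lambda>t. bump t ^ l) ((1 / R ^ a) *\<^sub>R t)
      * ((1 / R) ^ (2 * \<delta>) * (neg_laplacian ^^ \<delta>) (\<lambda>x. bump x ^ l) ((1 / R) *\<^sub>R x))
   + bump ((1 / R ^ a) *\<^sub>R t) ^ l * ((1 / R) ^ (2 * \<sigma>) * (neg_laplacian ^^ \<sigma>) (\<lambda>x. bump x ^ l) ((1 / R) *\<^sub>R x))"
  unfolding parabolic_test_def adjoint_op_product[OF smooth_dilated_bump smooth_dilated_bump]
    deriv_dilated_bump(2) unfolding deriv_dilated_bump(1) neg_laplacian_pow_dilated_bump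
  by (simp only: dilated_bump_def)

lemma abs_scaled_product_le:
  fixes c r x y :: real
  assumes "0 \<le> c" "c \<le> r" "\<bar>x\<bar> \<le> X * p" "\<bar>y\<bar> \<le> Y * q" "0 \<le> X" "0 \<le> p"
  shows "\<bar>c * (x * y)\<bar> \<le> r * (X * Y * (p * q))"
proof -
  have "\<bar>x\<bar> * \<bar>y\<bar> \<le> (X * p) * (Y * q)"
    using assms by (intro mult_mono) auto
  then have "c * (\<bar>x\<bar> * \<bar>y\<bar>) \<le> r * ((X * p) * (Y * q))"
    using assms by (intro mult_mono) auto
  then show ?thesis using assms(1) by (simp add: abs_mult mult_ac)
qed

text \<open>The powers of \<open>1/R\<close> in the three terms are \<open>2a\<close>, \<open>a + 2\<delta>\<close> and \<open>2\<sigma>\<close>; the assumptions on \<open>a\<close> say that none of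
  them is below \<open>2\<sigma>\<close>.\<close>

lemma adjoint_op_parabolic_test_bound:
  assumes "0 < \<delta>" "\<delta> \<le> \<sigma>" "\<sigma> \<le> a" "2 * \<sigma> \<le> a + 2 * \<delta>" "0 < j" "j + 2 * \<sigma> \<le> l"
  obtains B where "0 \<le> B" "\<And>R t x::'a::euclidean_space. 1 \<le> R \<Longrightarrow>
    \<bar>adjoint_op \<sigma> \<delta> (parabolic_test a l R) (t, x)\<bar>
      \<le> B * (1 / R) ^ (2 * \<sigma>) * (bump ((1 / R ^ a) *\<^sub>R t) ^ j * bump ((1 / R) *\<^sub>R x) ^ j)"
proof -
  obtain B1 where B1: "0 \<le> B1" "\<And>t::real. \<bar>deriv (\<lambda>t. bump t ^ l) t\<bar> \<le> B1 * bump t ^ j"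
    "\<And>t::real. \<bar>deriv (deriv (\<lambda>t. bump t ^ l)) t\<bar> \<le> B1 * bump t ^ j"
    by (rule deriv_bump_bound[of j l]) (use assms in auto)
  obtain B2 where B2: "0 \<le> B2" "\<And>x::'a. \<bar>(neg_laplacian ^^ \<delta>) (\<lambda>x. bump x ^ l) x\<bar> \<le> B2 * bump x ^ j"
    by (rule neg_laplacian_pow_bump_bound[of j \<delta> l]) (use assms in auto)
  obtain B3 where B3: "0 \<le> B3" "\<And>x::'a. \<bar>(neg_laplacian ^^ \<sigma>) (\<lambda>x. bump x ^ l) x\<bar> \<le> B3 * bump x ^ j"
    by (rule neg_laplacian_pow_bump_bound[of j \<sigma> l]) (use assms in auto)
  have pow: "bump y ^ l \<le> bump y ^ j" for y :: "'b::euclidean_space"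
    using assms by (intro power_decreasing) auto
  show ?thesis
  proof (rule that)
    show "0 \<le> B1 + B1 * B2 + B3" using B1 B2 B3 by simp
    fix R t :: real and x :: 'a assume R: "1 \<le> R"
    let ?t = "(1 / R ^ a) *\<^sub>R t" and ?x = "(1 / R) *\<^sub>R x"
    define r where "r = (1 / R) ^ (2 * \<sigma>)"
    define pt px Et Ex where "pt = bump ?t ^ j" and "px = bump ?x ^ j" and "Et = bump ?t ^ l" and "Ex = bump ?x ^ l"
    define d1 d2 where "d1 = deriv (\<lambda>t. bump t ^ l) ?t" and "d2 = deriv (deriv (\<lambda>t. bump t ^ l)) ?t"
    define L2 L3 where "L2 = (neg_laplacian ^^ \<delta>) (\<lambda>x. bump x ^ l) ?x" and "L3 = (neg_laplacian ^^ \<sigma>) (\<lambda>x. bump x ^ l) ?x"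
    have nn: "0 \<le> pt" "0 \<le> px" by (simp_all add: pt_def px_def)
    have R': "0 \<le> 1 / R" "1 / R \<le> 1" using R by auto
    have r: "0 \<le> r" using R' by (simp add: r_def)
    have e1: "(1 / R ^ a)\<^sup>2 \<le> r"
      unfolding r_def power_one_over[symmetric] power_mult[symmetric] using R' assms by (intro power_decreasing) auto
    have "(1 / R ^ a) * (1 / R) ^ (2 * \<delta>) = (1 / R) ^ (a + 2 * \<delta>)"
      by (simp add: power_add power_one_over)
    also have "\<dots> \<le> r"
      unfolding r_def using R' assms by (intro power_decreasing) auto
    finally have e2: "(1 / R ^ a) * (1 / R) ^ (2 * \<delta>) \<le> r" .
    have b: "\<bar>d2\<bar> \<le> B1 * pt" "\<bar>d1\<bar> \<le> B1 * pt" "\<bar>Et\<bar> \<le> 1 * pt" "\<bar>Ex\<bar> \<le> 1 * px" "\<bar>L2\<bar> \<le> B2 * px" "\<bar>L3\<bar> \<le> B3 * px"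
      using B1(2,3) B2(2) B3(2) pow by (simp_all add: d1_def d2_def Et_def Ex_def L2_def L3_def pt_def px_def)
    have "adjoint_op \<sigma> \<delta> (parabolic_test a l R) (t, x) =
        (1 / R ^ a)\<^sup>2 * d2 * Ex - (1 / R ^ a) * d1 * ((1 / R) ^ (2 * \<delta>) * L2) + Et * (r * L3)"
      unfolding adjoint_op_parabolic_test by (simp only: d1_def d2_def Et_def Ex_def L2_def L3_def r_def)
    also have "\<dots> = (1 / R ^ a)\<^sup>2 * (d2 * Ex) - ((1 / R ^ a) * (1 / R) ^ (2 * \<delta>)) * (d1 * L2) + r * (Et * L3)"
      by (simp only: mult_ac)
    also have "\<bar>\<dots>\<bar> \<le> r * (B1 * 1 * (pt * px)) + r * (B1 * B2 * (pt * px)) + r * (1 * B3 * (pt * px))"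
    proof -
      note bd = abs_scaled_product_le
      have "\<bar>(1 / R ^ a)\<^sup>2 * (d2 * Ex)\<bar> \<le> r * (B1 * 1 * (pt * px))"
        by (rule bd[OF _ e1 b(1,4)]) (use nn B1 in auto)
      moreover have "\<bar>((1 / R ^ a) * (1 / R) ^ (2 * \<delta>)) * (d1 * L2)\<bar> \<le> r * (B1 * B2 * (pt * px))"
        by (rule bd[OF _ e2 b(2,5)]) (use nn B1 B2 R in auto)
      moreover have "\<bar>r * (Et * L3)\<bar> \<le> r * (1 * B3 * (pt * px))"
        by (rule bd[OF r order_refl b(3,6)]) (use nn B3 in auto)
      ultimately show ?thesis by linarith
    qed
    also have "\<dots> = (B1 + B1 * B2 + B3) * r * (pt * px)" by (simp add: algebra_simps)
    finally show "\<bar>adjoint_op \<sigma> \<delta> (parabolic_test a l R) (t, x)\<bar>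
      \<le> (B1 + B1 * B2 + B3) * (1 / R) ^ (2 * \<sigma>) * (bump ?t ^ j * bump ?x ^ j)"
      by (simp only: r_def pt_def px_def)
  qed
qed

lemma neg_laplacian_pow_bump_0_on_plateau:
  assumes "norm x \<le> 1" "0 < m"
  shows "(neg_laplacian ^^ m) (\<lambda>x. bump x ^ l) x = 0"
proof (rule neg_laplacian_pow_0_of_locally_const[where S = "{x. (norm x)\<^sup>2 < 2}"])
  show "open {x::'a. (norm x)\<^sup>2 < 2}" by (intro open_Collect_less continuous_intros)
  show "x \<in> {x. (norm x)\<^sup>2 < 2}" using power_mono[OF assms(1), of 2] by simp
qed (use assms in \<open>auto simp: bump_eq_1\<close>)

lemma deriv_bump_power_0_on_plateau:
  fixes t :: real
  assumes "norm t \<le> 1"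
  shows "deriv (\<lambda>t. bump t ^ l) t = 0" "deriv (deriv (\<lambda>t. bump t ^ l)) t = 0"
proof -
  let ?S = "{x::real. (norm x)\<^sup>2 < 2}"
  have S: "open ?S" by (intro open_Collect_less continuous_intros)
  have t: "t \<in> ?S" using power_mono[OF assms(1), of 2] by simp
  have 1: "deriv (\<lambda>t. bump t ^ l) t = 0" if "t \<in> ?S" for t
    unfolding deriv_eq_partial_deriv
    by (rule partial_deriv_0_of_locally_const[OF S _ that, where c = 1]) (simp add: bump_eq_1)
  then show "deriv (\<lambda>t. bump t ^ l) t = 0" using t by blast
  show "deriv (deriv (\<lambda>t. bump t ^ l)) t = 0"
    unfolding deriv_eq_partial_deriv[of "deriv (\<lambda>t. bump t ^ l)"]
    by (rule partial_deriv_0_of_locally_const[OF S _ t, where c = 0]) (rule 1)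
qed

lemma adjoint_op_parabolic_test_eq_0:
  assumes "1 \<le> R" "z \<in> parabolic_box a R" "0 < \<sigma>"
  shows "adjoint_op \<sigma> \<delta> (parabolic_test a l R) z = 0"
proof -
  obtain t x where z: "z = (t, x)" by (cases z)
  have "norm ((1 / R ^ a) *\<^sub>R t) \<le> 1" "norm ((1 / R) *\<^sub>R x) \<le> 1"
    using assms by (auto simp: z parabolic_box_def)
  then show ?thesis
    unfolding z adjoint_op_parabolic_test
    using assms(3) by (simp only: neg_laplacian_pow_bump_0_on_plateau deriv_bump_power_0_on_plateau mult_zero_left mult_zero_right diff_self add_0)
qed

section \<open>The estimate for one equation\<close>

lemma sets_time_strip: "time_interval T \<times> (UNIV :: 'a::euclidean_space set) \<in> sets lebesgue"
proof -
  have "time_interval T \<in> sets borel"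
    by (cases T) (simp_all add: time_interval_def conj_commute flip: atLeast_def atLeastLessThan_def)
  then have "time_interval T \<times> (UNIV :: 'a set) \<in> sets borel"
    by (intro borel_Times) auto
  then show ?thesis by (simp add: sets_completionI_sets)
qed

lemma parabolic_box_subset_strip:
  assumes "ereal (R ^ a) < T"
  shows "parabolic_box a R \<subseteq> time_interval T \<times> UNIV"
proof -
  have "ereal t < T" if "t \<le> R ^ a" for t
    using that assms by (meson ereal_less_eq(3) le_less_trans)
  then show ?thesis by (auto simp: parabolic_box_def time_interval_def)
qed

lemma integral_lebesgue_on_eq_set_integral:
  fixes g :: "'a::euclidean_space \<Rightarrow> real"
  assumes "S \<in> sets lebesgue" "K \<subseteq> S" "\<And>z. z \<in> S - K \<Longrightarrow> g z = 0"
  shows "(LINT z|lebesgue_on S. g z) = (LINT z:K|lebesgue. g z)"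
proof -
  have "(\<lambda>z. indicator S z *\<^sub>R g z) = (\<lambda>z. indicator K z *\<^sub>R g z)"
  proof
    fix z show "indicator S z *\<^sub>R g z = indicator K z *\<^sub>R g z"
      using assms(2,3)[of] by (cases "z \<in> K"; cases "z \<in> S") (auto simp: assms(3))
  qed
  then show ?thesis
    using assms(1) by (simp only: integral_restrict_space set_lebesgue_integral_def) (simp add: integral_restrict_space)
qed

lemma local_Lp_set_integrable:
  assumes "f \<in> local_Lp r S" "compact K" "K \<subseteq> S"
  shows "set_integrable lebesgue K (\<lambda>z. \<bar>f z\<bar> powr r)"
proof -
  have "integrable (lebesgue_on K) (\<lambda>z. \<bar>f z\<bar> powr r)"
    using assms unfolding local_Lp_def Lp_def by auto
  moreover have "K \<in> sets lebesgue" using assms(2) by (simp add: lmeasurable_compact fmeasurableD)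
  ultimately show ?thesis by (simp add: integrable_restrict_space set_integrable_def)
qed

definition weighted_mass :: "nat \<Rightarrow> nat \<Rightarrow> real \<Rightarrow> real \<Rightarrow> (real \<times> 'a::euclidean_space \<Rightarrow> real) \<Rightarrow> real" where
  "weighted_mass a l R r f = (LINT z:parabolic_box a (2 * R)|lebesgue. \<bar>f z\<bar> powr r * parabolic_test a l R z)"

definition outer_mass :: "nat \<Rightarrow> nat \<Rightarrow> real \<Rightarrow> real \<Rightarrow> (real \<times> 'a::euclidean_space \<Rightarrow> real) \<Rightarrow> real" where
  "outer_mass a l R r f =
     (LINT z:parabolic_box a (2 * R) - parabolic_box a R|lebesgue. \<bar>f z\<bar> powr r * parabolic_test a l R z)"

lemma fmeasurable_parabolic_box: "parabolic_box a R \<in> lmeasurable"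
  by (simp add: lmeasurable_compact compact_parabolic_box)

lemma bump_rescaled_eq_0_outside:
  assumes "1 \<le> R" "0 < a" "0 \<le> t" "(t, x) \<notin> parabolic_box a (2 * R)"
  shows "bump ((1 / R ^ a) *\<^sub>R t) * bump ((1 / R) *\<^sub>R x) = 0"
proof -
  have "2 ^ 1 \<le> (2::real) ^ a" using assms by (intro power_increasing) auto
  then have "2 * R ^ a \<le> (2 * R) ^ a"
    using assms by (simp add: power_mult_distrib mult_right_mono)
  moreover have "(2 * R) ^ a < t \<or> 2 * R < norm x"
    using assms(3,4) by (auto simp: parabolic_box_def simp del: power_mult_distrib)
  ultimately have "2 * R ^ a \<le> t \<or> 2 * R \<le> norm x" by linarith
  moreover have "bump ((1 / R ^ a) *\<^sub>R t) = 0" if "2 * R ^ a \<le> t"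
    by (rule bump_eq_0) (use that assms in \<open>simp add: field_simps\<close>)
  moreover have "bump ((1 / R) *\<^sub>R x) = 0" if "2 * R \<le> norm x"
    by (rule bump_eq_0) (use that assms in \<open>simp add: field_simps\<close>)
  ultimately show ?thesis by auto
qed

text \<open>This is where the height \<open>l\<close> of the power enters: the factor \<open>y\<^sup>j\<close> left over by the derivatives is still
  at most the \<open>1/s\<close>-th power of the cutoff \<open>y\<^sup>l\<close>.\<close>

lemma powr_mult_power_le:
  fixes u y s :: real
  assumes "0 \<le> y" "y \<le> 1" "0 < s" "real l \<le> real j * s" "0 < l"
  shows "(\<bar>u\<bar> * y ^ j) powr s \<le> \<bar>u\<bar> powr s * y ^ l"
proof (cases "y = 0")
  case True
  have "0 < j" using assms by (cases j) auto
  then show ?thesis using True assms(5) by (simp add: zero_power)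
next
  case False
  then have y: "0 < y" using assms by simp
  have "(y ^ j) powr s = y powr (real j * s)" using y by (simp add: powr_realpow[symmetric] powr_powr)
  also have "\<dots> \<le> y powr real l" using y assms by (intro powr_mono') auto
  also have "\<dots> = y ^ l" using y by (simp add: powr_realpow)
  finally show ?thesis using assms(1) by (simp add: powr_mult mult_left_mono)
qed

text \<open>At \<open>t = 0\<close> the cutoff equals the spatial cutoff and its time derivative vanishes, so that the data enter
  only through \<open>data_pairing\<close>. On the right-hand side the adjoint operator restricts the integral to the
  region between two boxes, where Young's inequality is applied to \<open>\<bar>u\<bar> y\<^sup>j\<close> and \<open>B R powr (-2\<sigma>)\<close>; the
  second term is then integrated over a region of volume of order \<open>R ^ (a + n)\<close>.

  The constant is uniform in the solution, in its existence time and in the data, which the lifespan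
  estimate needs. The factor 2 in \<open>(2 R)\<^sup>a < T\<close> makes room for the support of the cutoff.\<close>

lemma weak_equation_estimate:
  fixes \<sigma> \<delta> a j l :: nat and s :: real
  assumes par: "0 < \<delta>" "\<delta> \<le> \<sigma>" "\<sigma> \<le> a" "2 * \<sigma> \<le> a + 2 * \<delta>"
    and l: "0 < j" "j + 2 * \<sigma> \<le> l" "real l \<le> real j * s" and s: "1 < s"
  obtains C where "0 \<le> C"
    "\<And>r T (u\<^sub>0 :: 'a::euclidean_space \<Rightarrow> real) u\<^sub>1 u z R c.
      1 \<le> R \<Longrightarrow> ereal ((2 * R) ^ a) < T \<Longrightarrow> 0 < c \<Longrightarrow> u\<^sub>1 \<in> Lp 1 UNIV \<Longrightarrow>
      weak_equation \<sigma> \<delta> r T u\<^sub>0 u\<^sub>1 u z \<Longrightarrow> (\<lambda>(t, x). u t x) \<in> local_Lp s (time_interval T \<times> UNIV) \<Longrightarrow>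
      weighted_mass a l R r (\<lambda>(t, x). z t x) + data_pairing \<delta> u\<^sub>0 u\<^sub>1 (dilated_bump l R)
      \<le> c * outer_mass a l R s (\<lambda>(t, x). u t x)
        + C * c powr (- 1 / (s - 1)) * R powr (a + DIM('a) - 2 * \<sigma> * s / (s - 1))"
proof -
  obtain B where B: "0 \<le> B" "\<And>R t x::'a. 1 \<le> R \<Longrightarrow>
    \<bar>adjoint_op \<sigma> \<delta> (parabolic_test a l R) (t, x)\<bar>
      \<le> B * (1 / R) ^ (2 * \<sigma>) * (bump ((1 / R ^ a) *\<^sub>R t) ^ j * bump ((1 / R) *\<^sub>R x) ^ j)"
    by (rule adjoint_op_parabolic_test_bound[OF par l(1,2), where 'a='a]) blast
  define C where "C = B powr (s / (s - 1)) * (unit_ball_vol (DIM('a)) * 2 ^ (a + DIM('a)))"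
  have a: "0 < a" "0 < \<sigma>" "0 < l" using par l by auto
  show ?thesis
  proof (rule that)
    show "0 \<le> C" by (simp add: C_def unit_ball_vol_nonneg)
    fix r T and u\<^sub>0 u\<^sub>1 :: "'a \<Rightarrow> real" and u z and R c :: real
    assume R: "1 \<le> R" and T: "ereal ((2 * R) ^ a) < T" and c: "0 < c" and u1: "u\<^sub>1 \<in> Lp 1 UNIV"
      and weak: "weak_equation \<sigma> \<delta> r T u\<^sub>0 u\<^sub>1 u z"
      and u: "(\<lambda>(t, x). u t x) \<in> local_Lp s (time_interval T \<times> UNIV)"
    define U Z where "U = (\<lambda>(t, x). u t x)" and "Z = (\<lambda>(t, x). z t x)"
    define \<phi> :: "real \<times> 'a \<Rightarrow> real" where "\<phi> = parabolic_test a l R"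
    define A where "A = adjoint_op \<sigma> \<delta> \<phi>"
    define S where "S = time_interval T \<times> (UNIV :: 'a set)"
    define K where "K = (parabolic_box a (2 * R) :: (real \<times> 'a) set)"
    define K' where "K' = K - parabolic_box a R"
    define y where "y = (\<lambda>(t::real, x::'a). bump ((1 / R ^ a) *\<^sub>R t) * bump ((1 / R) *\<^sub>R x))"
    define b where "b = B * (1 / R) ^ (2 * \<sigma>)"
    have b: "0 \<le> b" using B R by (simp add: b_def)
    have y: "0 \<le> y w" "y w \<le> 1" for w
      by (simp_all add: y_def case_prod_beta' mult_le_one)
    have \<phi>: "\<phi> w = y w ^ l" for w
      by (simp add: \<phi>_def parabolic_test_def dilated_bump_def y_def case_prod_beta' power_mult_distrib)
    have A: "\<bar>A w\<bar> \<le> b * y w ^ j" for w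
      using B(2)[OF R, of "fst w" "snd w"]
      by (simp add: A_def \<phi>_def b_def y_def case_prod_beta' power_mult_distrib)
    have y0: "y w = 0" if "w \<in> S - K" for w
    proof -
      obtain t x where w: "w = (t, x)" by (cases w)
      then have "0 \<le> t" "(t, x) \<notin> parabolic_box a (2 * R)"
        using that by (auto simp: S_def K_def time_interval_def)
      from bump_rescaled_eq_0_outside[OF R a(1) this] show ?thesis by (simp add: w y_def)
    qed
    have A0: "A w = 0" if "w \<in> S - K" for w
      using A[of w] y0[OF that] l(1) by (simp add: zero_power)
    have A0': "A w = 0" if "w \<in> parabolic_box a R" for w
      unfolding A_def \<phi>_def by (rule adjoint_op_parabolic_test_eq_0[OF R that a(2)])
    have S: "S \<in> sets lebesgue" unfolding S_def by (rule sets_time_strip)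
    have KS: "K \<subseteq> S" unfolding K_def S_def by (rule parabolic_box_subset_strip[OF T])
    have T': "ereal (2 * R ^ a) < T"
    proof -
      have "2 ^ 1 \<le> (2::real) ^ a" using a by (intro power_increasing) auto
      then have "2 * R ^ a \<le> (2 * R) ^ a"
        using R by (simp add: power_mult_distrib mult_right_mono)
      then show ?thesis using T by (meson ereal_less_eq(3) le_less_trans)
    qed
    have test: "\<phi> \<in> test_functions ({t. ereal t < T} \<times> UNIV)"
      unfolding \<phi>_def by (rule parabolic_test_test_function[OF R a(3) T'])
    obtain w where w: "has_neg_laplacian_pow \<delta> u\<^sub>0 w" and
      eq: "(LINT (t, x)|lebesgue_on S. \<bar>z t x\<bar> powr r * \<phi> (t, x))
        + (LINT x|lebesgue. (u\<^sub>1 x + w x) * \<phi> (0, x))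
      = (LINT x|lebesgue. u\<^sub>0 x * time_deriv \<phi> (0, x))
        + (LINT (t, x)|lebesgue_on S. u t x * (time_deriv (time_deriv \<phi>) (t, x)
                      - space_neg_laplacian_pow \<delta> (time_deriv \<phi>) (t, x)
                      + space_neg_laplacian_pow \<sigma> \<phi> (t, x)))"
      using weak test unfolding weak_equation_def S_def by blast
    have at0: "\<phi> (0, x) = dilated_bump l R x" for x
      using R by (simp add: \<phi>_def parabolic_test_def dilated_bump_eq_1)
    have td0: "time_deriv \<phi> (0, x) = 0" for x
      unfolding \<phi>_def parabolic_test_def time_deriv_product[OF smooth_dilated_bump]
      by (simp add: deriv_dilated_bump(1) deriv_bump_power_0_on_plateau)
    have lhs: "(LINT (t, x)|lebesgue_on S. \<bar>z t x\<bar> powr r * \<phi> (t, x)) = weighted_mass a l R r Z"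
    proof -
      have "(LINT (t, x)|lebesgue_on S. \<bar>z t x\<bar> powr r * \<phi> (t, x)) = (LINT v|lebesgue_on S. \<bar>Z v\<bar> powr r * \<phi> v)"
        by (simp add: Z_def case_prod_beta')
      also have "\<dots> = weighted_mass a l R r Z"
        unfolding weighted_mass_def K_def[symmetric] \<phi>_def[symmetric]
        by (rule integral_lebesgue_on_eq_set_integral[OF S KS]) (use y0 a in \<open>simp add: \<phi>\<close>)
      finally show ?thesis .
    qed
    have rhs: "(LINT (t, x)|lebesgue_on S. u t x * (time_deriv (time_deriv \<phi>) (t, x)
                      - space_neg_laplacian_pow \<delta> (time_deriv \<phi>) (t, x)
                      + space_neg_laplacian_pow \<sigma> \<phi> (t, x))) = (LINT v:K'|lebesgue. U v * A v)"
    proof -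
      have "(LINT (t, x)|lebesgue_on S. u t x * (time_deriv (time_deriv \<phi>) (t, x)
                      - space_neg_laplacian_pow \<delta> (time_deriv \<phi>) (t, x)
                      + space_neg_laplacian_pow \<sigma> \<phi> (t, x))) = (LINT v|lebesgue_on S. U v * A v)"
        by (simp add: U_def A_def adjoint_op_def case_prod_beta')
      also have "\<dots> = (LINT v:K'|lebesgue. U v * A v)"
      proof (rule integral_lebesgue_on_eq_set_integral[OF S])
        show "K' \<subseteq> S" using KS by (auto simp: K'_def)
        show "U v * A v = 0" if "v \<in> S - K'" for v
          using that A0 A0' by (cases "v \<in> K") (auto simp: K'_def)
      qed
      finally show ?thesis .
    qed
    have intU: "set_integrable lebesgue K' (\<lambda>v. \<bar>U v\<bar> powr s * \<phi> v)"
    proof (rule set_integrable_subset)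
      have "set_integrable lebesgue K (\<lambda>v. \<bar>U v\<bar> powr s)"
        by (rule local_Lp_set_integrable[OF u[folded U_def S_def] _ KS]) (simp add: K_def compact_parabolic_box)
      then show "set_integrable lebesgue K (\<lambda>v. \<bar>U v\<bar> powr s * \<phi> v)"
        by (rule set_integrable_continuous_mult) (simp_all add: K_def compact_parabolic_box \<phi>_def smooth_continuous smooth_parabolic_test)
      show "K' \<in> sets lebesgue" "K' \<subseteq> K"
        unfolding K'_def K_def by (auto intro: fmeasurableD fmeasurable_parabolic_box)
    qed
    define D where "D = c powr (- 1 / (s - 1)) * b powr (s / (s - 1))"
    have D: "0 \<le> D" by (simp add: D_def)
    have pt: "U v * A v \<le> c * (\<bar>U v\<bar> powr s * \<phi> v) + D" for v
    proof -
      have "U v * A v \<le> \<bar>U v\<bar> * \<bar>A v\<bar>" by (metis abs_ge_self abs_mult)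
      also have "\<dots> \<le> \<bar>U v\<bar> * (b * y v ^ j)" using A by (intro mult_left_mono) auto
      also have "\<dots> = (\<bar>U v\<bar> * y v ^ j) * b" by simp
      also have "\<dots> \<le> c * (\<bar>U v\<bar> * y v ^ j) powr s + D"
        unfolding D_def using y b c s by (intro Young_weighted) auto
      also have "c * (\<bar>U v\<bar> * y v ^ j) powr s \<le> c * (\<bar>U v\<bar> powr s * \<phi> v)"
        unfolding \<phi> using y c s l(3) a by (intro mult_left_mono powr_mult_power_le) auto
      finally show ?thesis by simp
    qed
    have meas: "K' \<in> lmeasurable" "measure lebesgue K' \<le> measure lebesgue K"
    proof -
      show K': "K' \<in> lmeasurable" unfolding K'_def K_def
        by (intro fmeasurable.Diff fmeasurable_parabolic_box)
      show "measure lebesgue K' \<le> measure lebesgue K"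
        by (rule measure_mono_fmeasurable) (use K' fmeasurableD in \<open>auto simp: K'_def K_def fmeasurable_parabolic_box\<close>)
    qed
    have intD: "set_integrable lebesgue K' (\<lambda>v. D)" "(LINT v:K'|lebesgue. D) = D * measure lebesgue K'"
      using meas(1) unfolding set_integrable_def set_lebesgue_integral_def
      by (auto simp: fmeasurable_def)
    have intc: "set_integrable lebesgue K' (\<lambda>v. c * (\<bar>U v\<bar> powr s * \<phi> v))"
      using intU by simp
    have "(LINT v:K'|lebesgue. U v * A v) \<le> (LINT v:K'|lebesgue. c * (\<bar>U v\<bar> powr s * \<phi> v) + D)"
      unfolding set_lebesgue_integral_def
    proof (rule integral_mono')
      show "integrable lebesgue (\<lambda>v. indicat_real K' v *\<^sub>R (c * (\<bar>U v\<bar> powr s * \<phi> v) + D))"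
        using set_integral_add(1)[OF intc intD(1)] by (simp only: set_integrable_def)
      show "indicat_real K' v *\<^sub>R (U v * A v) \<le> indicat_real K' v *\<^sub>R (c * (\<bar>U v\<bar> powr s * \<phi> v) + D)" for v
        using pt[of v] by (simp add: indicator_def)
      show "0 \<le> indicat_real K' v *\<^sub>R (c * (\<bar>U v\<bar> powr s * \<phi> v) + D)" for v
        using c D y by (simp add: \<phi>)
    qed
    also have "\<dots> = c * outer_mass a l R s U + D * measure lebesgue K'"
      unfolding set_integral_add(2)[OF intc intD(1)] intD(2) outer_mass_def K_def[symmetric] K'_def[symmetric] \<phi>_def[symmetric]
      by simp
    also have "\<dots> \<le> c * outer_mass a l R s U + D * measure lebesgue K"
      using meas(2) D by (intro add_left_mono mult_left_mono)
    also have "D * measure lebesgue K = C * c powr (- 1 / (s - 1)) * R powr (a + DIM('a) - 2 * \<sigma> * s / (s - 1))"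
    proof -
      have "measure lebesgue K = unit_ball_vol (DIM('a)) * 2 ^ (a + DIM('a)) * R powr (a + DIM('a))"
        unfolding K_def using R by (subst measure_parabolic_box) (simp_all add: power_mult_distrib powr_realpow[symmetric] flip: of_nat_add)
      moreover have "b powr (s / (s - 1)) = B powr (s / (s - 1)) * R powr (- (2 * \<sigma> * s / (s - 1)))"
      proof -
        have "(1 / R) ^ (2 * \<sigma>) = R powr (- (2 * \<sigma>))"
          using R powr_realpow[of R "2 * \<sigma>"] by (simp add: powr_minus_divide power_one_over)
        then show ?thesis using R B unfolding b_def by (simp add: powr_mult powr_powr)
      qed
      ultimately have "D * measure lebesgue K = C * c powr (- 1 / (s - 1)) * (R powr (a + DIM('a)) * R powr (- (2 * \<sigma> * s / (s - 1))))"
        by (simp add: D_def C_def)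
      then show ?thesis by (simp add: powr_add[symmetric])
    qed
    finally have main: "(LINT v:K'|lebesgue. U v * A v) \<le> c * outer_mass a l R s U
       + C * c powr (- 1 / (s - 1)) * R powr (a + DIM('a) - 2 * \<sigma> * s / (s - 1))" by simp
    have "weighted_mass a l R r Z + data_pairing \<delta> u\<^sub>0 u\<^sub>1 (dilated_bump l R) = (LINT v:K'|lebesgue. U v * A v)"
      using eq unfolding lhs rhs td0 at0
      using integral_data_eq_pairing[OF u1 w dilated_bump_test_function[of l R]] a R by simp
    with main show "weighted_mass a l R r (\<lambda>(t, x). z t x) + data_pairing \<delta> u\<^sub>0 u\<^sub>1 (dilated_bump l R)
      \<le> c * outer_mass a l R s (\<lambda>(t, x). u t x)
        + C * c powr (- 1 / (s - 1)) * R powr (a + DIM('a) - 2 * \<sigma> * s / (s - 1))"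
      by (simp only: U_def Z_def)
  qed
qed

section \<open>The estimate for the system\<close>

definition box_mass :: "nat \<Rightarrow> real \<Rightarrow> real \<Rightarrow> (real \<times> 'a::euclidean_space \<Rightarrow> real) \<Rightarrow> real" where
  "box_mass a R r f = (LINT z:parabolic_box a R|lebesgue. \<bar>f z\<bar> powr r)"

text \<open>The outer mass is dominated by an increment of the mass over boxes. Such increments tend to 0
  along a geometric sequence of radii once the mass over boxes is bounded.\<close>

lemma mass_comparison:
  fixes f :: "real \<times> 'a::euclidean_space \<Rightarrow> real"
  assumes R: "1 \<le> R" and T: "ereal ((2 * R) ^ a) < T" and f: "f \<in> local_Lp r (time_interval T \<times> UNIV)"
  shows "outer_mass a l R r f \<le> weighted_mass a l R r f"
    and "box_mass a R r f \<le> weighted_mass a l R r f"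
    and "outer_mass a l R r f \<le> box_mass a (2 * R) r f - box_mass a R r f"
    and "0 \<le> box_mass a R r f"
proof -
  let ?K = "parabolic_box a (2 * R) :: (real \<times> 'a) set" and ?B = "parabolic_box a R :: (real \<times> 'a) set"
  let ?\<phi> = "parabolic_test a l R :: real \<times> 'a \<Rightarrow> real"
  have K: "set_integrable lebesgue ?K (\<lambda>z. \<bar>f z\<bar> powr r)"
    by (rule local_Lp_set_integrable[OF f compact_parabolic_box parabolic_box_subset_strip[OF T]])
  have BK: "?B \<subseteq> ?K" by (rule parabolic_box_subset[OF R])
  have m: "?B \<in> sets lebesgue" "?K - ?B \<in> sets lebesgue"
    by (auto intro!: fmeasurableD fmeasurable_parabolic_box fmeasurable.Diff)
  have K\<phi>: "set_integrable lebesgue ?K (\<lambda>z. \<bar>f z\<bar> powr r * ?\<phi> z)"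
    by (rule set_integrable_continuous_mult[OF K compact_parabolic_box])
       (simp add: smooth_continuous smooth_parabolic_test)
  have B: "set_integrable lebesgue ?B (\<lambda>z. \<bar>f z\<bar> powr r)" "set_integrable lebesgue (?K - ?B) (\<lambda>z. \<bar>f z\<bar> powr r)"
    "set_integrable lebesgue ?B (\<lambda>z. \<bar>f z\<bar> powr r * ?\<phi> z)" "set_integrable lebesgue (?K - ?B) (\<lambda>z. \<bar>f z\<bar> powr r * ?\<phi> z)"
    using BK m by (auto intro: set_integrable_subset[OF K] set_integrable_subset[OF K\<phi>])
  have split: "?K = ?B \<union> (?K - ?B)" using BK by blast
  have W: "weighted_mass a l R r f = (LINT z:?B|lebesgue. \<bar>f z\<bar> powr r * ?\<phi> z) + outer_mass a l R r f"
    unfolding weighted_mass_def outer_mass_def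
    by (subst split, rule set_integral_Un) (use B in auto)
  have G: "box_mass a (2 * R) r f = box_mass a R r f + (LINT z:?K - ?B|lebesgue. \<bar>f z\<bar> powr r)"
    unfolding box_mass_def
    by (subst split, rule set_integral_Un) (use B in auto)
  have in_B: "(LINT z:?B|lebesgue. \<bar>f z\<bar> powr r * ?\<phi> z) = box_mass a R r f"
    unfolding box_mass_def set_lebesgue_integral_def
    by (intro Bochner_Integration.integral_cong refl) (auto simp: indicator_def parabolic_test_eq_1[OF R])
  show pos: "0 \<le> box_mass a R r f"
    unfolding box_mass_def set_lebesgue_integral_def by (intro Bochner_Integration.integral_nonneg) simp
  have outer0: "0 \<le> outer_mass a l R r f"
    unfolding outer_mass_def set_lebesgue_integral_def by (intro Bochner_Integration.integral_nonneg) simp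
  show "outer_mass a l R r f \<le> weighted_mass a l R r f" using W in_B pos by simp
  show "box_mass a R r f \<le> weighted_mass a l R r f" using W in_B outer0 by simp
  have "outer_mass a l R r f \<le> (LINT z:?K - ?B|lebesgue. \<bar>f z\<bar> powr r)"
    unfolding outer_mass_def by (rule set_integral_mono[OF B(4,2)]) (simp add: mult_left_le)
  then show "outer_mass a l R r f \<le> box_mass a (2 * R) r f - box_mass a R r f" using G by simp
qed

text \<open>The exponent \<open>s\<close> of the weight \<open>R\<^sup>s\<close> is the one for which the error terms of the two equations decay at the
  same rate \<open>R powr (-D)\<close>.\<close>

lemma balanced_exponents:
  fixes p q \<sigma> k n :: real
  assumes "1 < p" "1 < q"
  defines "s \<equiv> 2 * \<sigma> * (q - p) / (p * q - 1)" and "D \<equiv> k + 2 * \<sigma> * (1 + p) / (p * q - 1) - n"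
  shows "- s / (q - 1) + (2 * \<sigma> - k + n - 2 * \<sigma> * q / (q - 1)) = - D"
    and "s + s / (p - 1) + (2 * \<sigma> - k + n - 2 * \<sigma> * p / (p - 1)) = - D"
proof -
  have pq: "p * q - 1 > 0" using assms(1,2) mult_strict_mono[of 1 p 1 q] by simp
  define d where "d = p * q - 1"
  have d: "d > 0" "p * q = d + 1" using pq by (simp_all add: d_def)
  have 1: "(s + 2 * \<sigma> * q) / (q - 1) = 2 * \<sigma> * (1 + p) / d + 2 * \<sigma>"
  proof -
    have "(s + 2 * \<sigma> * q) * d = 2 * \<sigma> * ((q - p) + q * d)"
      using d(1) by (simp add: s_def d_def[symmetric] field_simps)
    also have "\<dots> = 2 * \<sigma> * ((1 + p) + d) * (q - 1)"
      unfolding d_def by algebra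
    finally show ?thesis using d(1) assms(2) by (simp add: field_simps)
  qed
  have 2: "(2 * \<sigma> * p - s * p) / (p - 1) = 2 * \<sigma> * (1 + p) / d + 2 * \<sigma>"
  proof -
    have "(2 * \<sigma> * p - s * p) * d = 2 * \<sigma> * p * (d - (q - p))"
      using d(1) by (simp add: s_def d_def[symmetric] field_simps)
    also have "\<dots> = 2 * \<sigma> * ((1 + p) + d) * (p - 1)"
      unfolding d_def by algebra
    finally show ?thesis using d(1) assms(1) by (simp add: field_simps)
  qed
  show "- s / (q - 1) + (2 * \<sigma> - k + n - 2 * \<sigma> * q / (q - 1)) = - D"
    using 1 unfolding D_def d_def by (simp add: add_divide_distrib)
  have "s + s / (p - 1) = s * p / (p - 1)" using assms(1) by (simp add: field_simps)
  then show "s + s / (p - 1) + (2 * \<sigma> - k + n - 2 * \<sigma> * p / (p - 1)) = - D"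
    using 2 unfolding D_def d_def by (simp add: diff_divide_distrib)
qed

text \<open>The equation for \<open>u\<close> is used with the weight \<open>K' R\<^sup>s\<close>. In it, the mass of \<open>u\<close> is replaced by the bound
  that the equation for \<open>v\<close> with the weight \<open>K R\<^sup>-\<^sup>s\<close> gives. The powers of \<open>R\<close> in front of the outer mass of
  \<open>v\<close> cancel, and both constants stay free.\<close>

lemma system_estimate:
  fixes \<sigma> \<delta> :: nat and p q :: real
  assumes \<sigma>: "0 < \<delta>" "\<delta> < \<sigma>" and pq: "1 < p" "1 < q"
  defines "a \<equiv> 2 * \<sigma> - k_minus \<sigma> \<delta>"
    and "D \<equiv> k_minus \<sigma> \<delta> + 2 * \<sigma> * (1 + p) / (p * q - 1) - DIM('a)"
  obtains l C where "0 < l" "0 \<le> C"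
    "\<And>T (u\<^sub>0 :: 'a::euclidean_space \<Rightarrow> real) u\<^sub>1 v\<^sub>0 v\<^sub>1 u v R K K'.
      1 \<le> R \<Longrightarrow> ereal ((2 * R) ^ a) < T \<Longrightarrow> 0 < K \<Longrightarrow> 0 < K' \<Longrightarrow> u\<^sub>1 \<in> Lp 1 UNIV \<Longrightarrow> v\<^sub>1 \<in> Lp 1 UNIV \<Longrightarrow>
      weak_solution \<sigma> \<delta> p q T u\<^sub>0 u\<^sub>1 v\<^sub>0 v\<^sub>1 u v \<Longrightarrow> 0 \<le> data_pairing \<delta> v\<^sub>0 v\<^sub>1 (dilated_bump l R) \<Longrightarrow>
      weighted_mass a l R p (\<lambda>(t, x). v t x) + data_pairing \<delta> u\<^sub>0 u\<^sub>1 (dilated_bump l R)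
      \<le> K * K' * outer_mass a l R p (\<lambda>(t, x). v t x)
        + C * (K' powr (- 1 / (q - 1)) + K' * K powr (- 1 / (p - 1))) * R powr - D"
proof -
  \<comment> \<open>Large enough that \<open>l - 2\<sigma> \<ge> l/p\<close> and \<open>l - 2\<sigma> \<ge> l/q\<close>.\<close>
  define j where "j = nat \<lceil>2 * real \<sigma> / (min p q - 1)\<rceil> + 1"
  define l where "l = j + 2 * \<sigma>"
  have "2 * real \<sigma> / (min p q - 1) \<le> real j" unfolding j_def by linarith
  then have "2 * real \<sigma> \<le> real j * (min p q - 1)" using pq by (simp add: pos_divide_le_eq)
  then have "real l \<le> real j * min p q" by (simp add: l_def algebra_simps)
  moreover have "real j * min p q \<le> real j * p" "real j * min p q \<le> real j * q"
    by (auto intro: mult_left_mono)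
  ultimately have lj: "real l \<le> real j * p" "real l \<le> real j * q" by linarith+
  have j: "0 < j" "j + 2 * \<sigma> \<le> l" by (simp_all add: j_def l_def)
  have par: "0 < \<delta>" "\<delta> \<le> \<sigma>" "\<sigma> \<le> a" "2 * \<sigma> \<le> a + 2 * \<delta>"
    using \<sigma> by (auto simp: a_def k_minus_def)
  obtain C1 where C1: "0 \<le> C1" "\<And>r T (u\<^sub>0 :: 'a \<Rightarrow> real) u\<^sub>1 u z R c.
      1 \<le> R \<Longrightarrow> ereal ((2 * R) ^ a) < T \<Longrightarrow> 0 < c \<Longrightarrow> u\<^sub>1 \<in> Lp 1 UNIV \<Longrightarrow>
      weak_equation \<sigma> \<delta> r T u\<^sub>0 u\<^sub>1 u z \<Longrightarrow> (\<lambda>(t, x). u t x) \<in> local_Lp q (time_interval T \<times> UNIV) \<Longrightarrow>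
      weighted_mass a l R r (\<lambda>(t, x). z t x) + data_pairing \<delta> u\<^sub>0 u\<^sub>1 (dilated_bump l R)
      \<le> c * outer_mass a l R q (\<lambda>(t, x). u t x)
        + C1 * c powr (- 1 / (q - 1)) * R powr (a + DIM('a) - 2 * \<sigma> * q / (q - 1))"
    using weak_equation_estimate[OF par j lj(2) pq(2), where 'a='a] by blast
  obtain C2 where C2: "0 \<le> C2" "\<And>r T (u\<^sub>0 :: 'a \<Rightarrow> real) u\<^sub>1 u z R c.
      1 \<le> R \<Longrightarrow> ereal ((2 * R) ^ a) < T \<Longrightarrow> 0 < c \<Longrightarrow> u\<^sub>1 \<in> Lp 1 UNIV \<Longrightarrow>
      weak_equation \<sigma> \<delta> r T u\<^sub>0 u\<^sub>1 u z \<Longrightarrow> (\<lambda>(t, x). u t x) \<in> local_Lp p (time_interval T \<times> UNIV) \<Longrightarrow>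
      weighted_mass a l R r (\<lambda>(t, x). z t x) + data_pairing \<delta> u\<^sub>0 u\<^sub>1 (dilated_bump l R)
      \<le> c * outer_mass a l R p (\<lambda>(t, x). u t x)
        + C2 * c powr (- 1 / (p - 1)) * R powr (a + DIM('a) - 2 * \<sigma> * p / (p - 1))"
    using weak_equation_estimate[OF par j lj(1) pq(1), where 'a='a] by blast
  show ?thesis
  proof (rule that)
    show "0 < l" using j by simp
    show "0 \<le> max C1 C2" using C1 by simp
    fix T and u\<^sub>0 u\<^sub>1 v\<^sub>0 v\<^sub>1 :: "'a \<Rightarrow> real" and u v and R K K' :: real
    assume R: "1 \<le> R" and T: "ereal ((2 * R) ^ a) < T" and K: "0 < K" "0 < K'"
      and L1: "u\<^sub>1 \<in> Lp 1 UNIV" "v\<^sub>1 \<in> Lp 1 UNIV"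
      and sol: "weak_solution \<sigma> \<delta> p q T u\<^sub>0 u\<^sub>1 v\<^sub>0 v\<^sub>1 u v"
      and mv: "0 \<le> data_pairing \<delta> v\<^sub>0 v\<^sub>1 (dilated_bump l R)"
    define s where "s = 2 * \<sigma> * (q - p) / (p * q - 1)"
    let ?U = "\<lambda>(t, x). u t x" and ?V = "\<lambda>(t, x). v t x"
    have loc: "?U \<in> local_Lp q (time_interval T \<times> UNIV)" "?V \<in> local_Lp p (time_interval T \<times> UNIV)"
      and eqs: "weak_equation \<sigma> \<delta> p T u\<^sub>0 u\<^sub>1 u v" "weak_equation \<sigma> \<delta> q T v\<^sub>0 v\<^sub>1 v u"
      using sol by (auto simp: weak_solution_def)
    have Rpos: "0 < R" using R by simp
    have N: "real a + real DIM('a) = 2 * real \<sigma> - real (k_minus \<sigma> \<delta>) + real DIM('a)"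
      by (simp add: a_def k_minus_def of_nat_diff)
    have ex: "- s / (q - 1) + (real a + real DIM('a) - 2 * real \<sigma> * q / (q - 1)) = - D"
      "s + s / (p - 1) + (real a + real DIM('a) - 2 * real \<sigma> * p / (p - 1)) = - D"
      unfolding s_def D_def N of_nat_mult of_nat_numeral by (rule balanced_exponents[OF pq])+
    let ?c = "K' * R powr s" and ?d = "K * R powr - s"
    have c: "0 < ?c" and d: "0 < ?d" using K Rpos by auto
    have e1: "?c powr (- 1 / (q - 1)) * R powr (a + DIM('a) - 2 * \<sigma> * q / (q - 1)) = K' powr (- 1 / (q - 1)) * R powr - D"
    proof -
      have "?c powr (- 1 / (q - 1)) = K' powr (- 1 / (q - 1)) * R powr (- s / (q - 1))"
        using K Rpos by (simp add: powr_mult powr_powr)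
      then show ?thesis
        unfolding ex(1)[symmetric] by (simp only: powr_add of_nat_add of_nat_mult of_nat_numeral mult.assoc)
    qed
    have e2: "?c * (?d powr (- 1 / (p - 1)) * R powr (a + DIM('a) - 2 * \<sigma> * p / (p - 1))) = K' * K powr (- 1 / (p - 1)) * R powr - D"
    proof -
      have "?d powr (- 1 / (p - 1)) = K powr (- 1 / (p - 1)) * R powr (s / (p - 1))"
        using K Rpos by (simp add: powr_mult powr_powr)
      then have "?c * (?d powr (- 1 / (p - 1)) * R powr (a + DIM('a) - 2 * \<sigma> * p / (p - 1)))
        = K' * K powr (- 1 / (p - 1)) * (R powr s * (R powr (s / (p - 1)) * R powr (a + DIM('a) - 2 * \<sigma> * p / (p - 1))))"
        by (simp only: mult_ac)
      also have "R powr s * (R powr (s / (p - 1)) * R powr (a + DIM('a) - 2 * \<sigma> * p / (p - 1))) = R powr - D"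
        unfolding ex(2)[symmetric] by (simp only: powr_add of_nat_add of_nat_mult of_nat_numeral mult.assoc)
      finally show ?thesis .
    qed
    have cd: "?c * ?d = K * K'"
      using Rpos by (simp add: powr_minus_divide)
    have E1: "weighted_mass a l R p ?V + data_pairing \<delta> u\<^sub>0 u\<^sub>1 (dilated_bump l R)
        \<le> ?c * outer_mass a l R q ?U + C1 * (K' powr (- 1 / (q - 1)) * R powr - D)"
      using C1(2)[OF R T c L1(1) eqs(1) loc(1)] unfolding mult.assoc[of C1] e1 .
    have "weighted_mass a l R q ?U
        \<le> ?d * outer_mass a l R p ?V + C2 * (?d powr (- 1 / (p - 1)) * R powr (a + DIM('a) - 2 * \<sigma> * p / (p - 1)))"
      using C2(2)[OF R T d L1(2) eqs(2) loc(2)] mv by simp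
    then have "outer_mass a l R q ?U
        \<le> ?d * outer_mass a l R p ?V + C2 * (?d powr (- 1 / (p - 1)) * R powr (a + DIM('a) - 2 * \<sigma> * p / (p - 1)))"
      using mass_comparison(1)[OF R T loc(1), of l] by linarith
    then have "?c * outer_mass a l R q ?U
        \<le> ?c * (?d * outer_mass a l R p ?V + C2 * (?d powr (- 1 / (p - 1)) * R powr (a + DIM('a) - 2 * \<sigma> * p / (p - 1))))"
      using c by (intro mult_left_mono) auto
    also have "\<dots> = (?c * ?d) * outer_mass a l R p ?V
        + C2 * (?c * (?d powr (- 1 / (p - 1)) * R powr (a + DIM('a) - 2 * \<sigma> * p / (p - 1))))"
      by (simp only: distrib_left mult_ac)
    finally have E2: "?c * outer_mass a l R q ?U
        \<le> K * K' * outer_mass a l R p ?V + C2 * (K' * K powr (- 1 / (p - 1)) * R powr - D)"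
      unfolding cd e2 .
    have "C1 * (K' powr (- 1 / (q - 1)) * R powr - D) \<le> max C1 C2 * (K' powr (- 1 / (q - 1)) * R powr - D)"
      by (intro mult_right_mono) auto
    moreover have "C2 * (K' * K powr (- 1 / (p - 1)) * R powr - D) \<le> max C1 C2 * (K' * K powr (- 1 / (p - 1)) * R powr - D)"
      using K by (intro mult_right_mono) auto
    ultimately have "weighted_mass a l R p ?V + data_pairing \<delta> u\<^sub>0 u\<^sub>1 (dilated_bump l R)
        \<le> K * K' * outer_mass a l R p ?V + (max C1 C2 * (K' powr (- 1 / (q - 1)) * R powr - D)
          + max C1 C2 * (K' * K powr (- 1 / (p - 1)) * R powr - D))"
      using E1 E2 by linarith
    also have "max C1 C2 * (K' powr (- 1 / (q - 1)) * R powr - D) + max C1 C2 * (K' * K powr (- 1 / (p - 1)) * R powr - D)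
       = max C1 C2 * (K' powr (- 1 / (q - 1)) + K' * K powr (- 1 / (p - 1))) * R powr - D"
      by (simp only: distrib_left distrib_right mult.assoc)
    finally show "weighted_mass a l R p ?V + data_pairing \<delta> u\<^sub>0 u\<^sub>1 (dilated_bump l R)
      \<le> K * K' * outer_mass a l R p ?V
        + max C1 C2 * (K' powr (- 1 / (q - 1)) + K' * K powr (- 1 / (p - 1))) * R powr - D" .
  qed
qed

section \<open>Nonexistence and lifespan\<close>

text \<open>First \<open>K'\<close> is taken large to make the first term small, then \<open>K\<close> large in terms of \<open>K'\<close>.\<close>

lemma exists_balanced_constants:
  fixes C d e m :: real
  assumes "0 < d" "0 < e" "0 < m"
  obtains K K' where "0 < K" "0 < K'" "C * (K' powr - d + K' * K powr - e) < m"
proof -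
  have lim: "((\<lambda>x. c * x powr - b) \<longlongrightarrow> 0) at_top" if "0 < b" for b c :: real
    using tendsto_mult[OF tendsto_const[of c] tendsto_neg_powr[of "- b", OF _ filterlim_ident]] that by simp
  have pick: "\<exists>x>0. c * x powr - b < m / 2" if "0 < b" for b c :: real
  proof -
    have "\<forall>\<^sub>F x in at_top. c * x powr - b < m / 2"
      by (rule order_tendstoD(2)[OF lim[OF that]]) (use assms(3) in simp)
    from eventually_happens'[OF trivial_limit_at_top_linorder eventually_conj[OF eventually_gt_at_top[of 0] this]]
    show ?thesis by blast
  qed
  obtain K' where K': "0 < K'" "C * K' powr - d < m / 2" using pick[OF assms(1)] by blast
  obtain K where K: "0 < K" "(C * K') * K powr - e < m / 2" using pick[OF assms(2)] by blast
  have "C * (K' powr - d + K' * K powr - e) < m"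
    using K(2) K'(2) by (simp add: algebra_simps)
  with K(1) K'(1) show ?thesis by (rule that)
qed

lemma increments_tendsto_0:
  fixes G :: "nat \<Rightarrow> real"
  assumes "\<And>k. G k \<le> G (Suc k)" "\<And>k. G k \<le> M" 
  shows "(\<lambda>k. G (Suc k) - G k) \<longlonglongrightarrow> 0"
proof -
  have "incseq G" using assms(1) by (rule incseq_SucI)
  then obtain L where L: "G \<longlonglongrightarrow> L"
    using assms(2) incseq_convergent by blast
  from tendsto_diff[OF LIMSEQ_Suc[OF L] L] show ?thesis by simp
qed

text \<open>With \<open>K = 1/2\<close> and \<open>K' = 1\<close> the outer mass is absorbed by the left-hand side, and the mass of \<open>v\<close> over
  boxes stays bounded. The outer mass therefore tends to 0 along dyadic radii, and the system estimate
  leaves only the error term, which can be made smaller than \<open>m\<close>. The bound \<open>R powr (-D) \<le> 1\<close> is all that is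
  used of \<open>D\<close>, so the critical dimension is included.\<close>

lemma no_global_weak_solution:
  fixes \<sigma> \<delta> :: nat and p q :: real
    and u\<^sub>0 u\<^sub>1 v\<^sub>0 v\<^sub>1 :: "'a::euclidean_space \<Rightarrow> real"
  assumes \<sigma>: "0 < \<delta>" "\<delta> < \<sigma>" and pq: "1 < p" "1 < q"
    and L1: "u\<^sub>1 \<in> Lp 1 UNIV" "v\<^sub>1 \<in> Lp 1 UNIV"
    and pos: "positive_mass \<delta> u\<^sub>0 u\<^sub>1" "positive_mass \<delta> v\<^sub>0 v\<^sub>1"
    and dim: "DIM('a) \<le> k_minus \<sigma> \<delta> + 2 * \<sigma> * (1 + p) / (p * q - 1)"
  shows "\<not> weak_solution \<sigma> \<delta> p q \<infinity> u\<^sub>0 u\<^sub>1 v\<^sub>0 v\<^sub>1 u v"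
proof
  assume sol: "weak_solution \<sigma> \<delta> p q \<infinity> u\<^sub>0 u\<^sub>1 v\<^sub>0 v\<^sub>1 u v"
  define a where "a = 2 * \<sigma> - k_minus \<sigma> \<delta>"
  define D where "D = k_minus \<sigma> \<delta> + 2 * \<sigma> * (1 + p) / (p * q - 1) - DIM('a)"
  have D: "0 \<le> D" using dim by (simp add: D_def)
  let ?V = "\<lambda>(t, x). v t x"
  obtain l C where l: "0 < l" "0 \<le> C" and est:
    "\<And>T (u\<^sub>0 :: 'a \<Rightarrow> real) u\<^sub>1 v\<^sub>0 v\<^sub>1 u v R K K'.
      1 \<le> R \<Longrightarrow> ereal ((2 * R) ^ a) < T \<Longrightarrow> 0 < K \<Longrightarrow> 0 < K' \<Longrightarrow> u\<^sub>1 \<in> Lp 1 UNIV \<Longrightarrow> v\<^sub>1 \<in> Lp 1 UNIV \<Longrightarrow>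
      weak_solution \<sigma> \<delta> p q T u\<^sub>0 u\<^sub>1 v\<^sub>0 v\<^sub>1 u v \<Longrightarrow> 0 \<le> data_pairing \<delta> v\<^sub>0 v\<^sub>1 (dilated_bump l R) \<Longrightarrow>
      weighted_mass a l R p (\<lambda>(t, x). v t x) + data_pairing \<delta> u\<^sub>0 u\<^sub>1 (dilated_bump l R)
      \<le> K * K' * outer_mass a l R p (\<lambda>(t, x). v t x)
        + C * (K' powr (- 1 / (q - 1)) + K' * K powr (- 1 / (p - 1))) * R powr - D"
    using system_estimate[OF \<sigma> pq, where 'a='a, folded a_def D_def] by blast
  obtain m Ru where m: "0 < m" "1 \<le> Ru" "\<And>R. Ru \<le> R \<Longrightarrow> m \<le> data_pairing \<delta> u\<^sub>0 u\<^sub>1 (dilated_bump l R)"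
    using positive_mass_pairing[OF pos(1) L1(1) l(1)] by blast
  obtain mv Rv where mv: "0 < mv" "1 \<le> Rv" "\<And>R. Rv \<le> R \<Longrightarrow> mv \<le> data_pairing \<delta> v\<^sub>0 v\<^sub>1 (dilated_bump l R)"
    using positive_mass_pairing[OF pos(2) L1(2) l(1)] by blast
  define R0 where "R0 = max Ru Rv"
  have loc: "?V \<in> local_Lp p (time_interval \<infinity> \<times> UNIV)"
    using sol by (simp add: weak_solution_def)
  define E where "E K K' = C * (K' powr (- 1 / (q - 1)) + K' * K powr (- 1 / (p - 1)))" for K K'
  have ineq: "weighted_mass a l R p ?V + m \<le> K * K' * outer_mass a l R p ?V + E K K'"
    if R: "R0 \<le> R" and K: "0 < K" "0 < K'" for R K K'
  proof -
    have R': "1 \<le> R" "Ru \<le> R" "Rv \<le> R" using R m(2) by (auto simp: R0_def)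
    have "weighted_mass a l R p ?V + data_pairing \<delta> u\<^sub>0 u\<^sub>1 (dilated_bump l R)
      \<le> K * K' * outer_mass a l R p ?V + E K K' * R powr - D"
      unfolding E_def by (rule est[OF R'(1) _ K L1 sol]) (use mv(1) mv(3)[OF R'(3)] in auto)
    moreover have "R powr - D \<le> 1"
      using R'(1) D powr_mono[of "- D" 0 R] by simp
    then have "E K K' * R powr - D \<le> E K K'"
      using l(2) K unfolding E_def by (intro mult_left_le mult_nonneg_nonneg add_nonneg_nonneg) auto
    ultimately show ?thesis using m(3)[OF R'(2)] by linarith
  qed
  note cmp = mass_comparison[where T = \<infinity>, OF _ _ loc]
  have bounded: "box_mass a R p ?V \<le> 2 * E (1/2) 1" if R: "R0 \<le> R" for R
  proof -
    have R1: "1 \<le> R" using R m(2) by (auto simp: R0_def)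
    have "weighted_mass a l R p ?V + m \<le> 1/2 * 1 * outer_mass a l R p ?V + E (1/2) 1"
      by (rule ineq[OF R]) auto
    with cmp(1)[OF R1, of a l] cmp(2)[OF R1, of a l] m(1) show ?thesis by simp
  qed
  define G where "G k = box_mass a (2 ^ k * R0) p ?V" for k
  have R0: "1 \<le> 2 ^ k * R0" "R0 \<le> 2 ^ k * R0" for k :: nat
  proof -
    have "1 \<le> R0" using m(2) by (simp add: R0_def)
    then show "R0 \<le> 2 ^ k * R0" using mult_right_mono[of 1 "2 ^ k" R0] by simp
    with \<open>1 \<le> R0\<close> show "1 \<le> 2 ^ k * R0" by linarith
  qed
  have GS: "G (Suc k) = box_mass a (2 * (2 ^ k * R0)) p ?V" for k
    by (simp add: G_def mult.assoc)
  have out0: "0 \<le> outer_mass a l R p ?V" for R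
    unfolding outer_mass_def set_lebesgue_integral_def by (intro Bochner_Integration.integral_nonneg) simp
  have outG: "outer_mass a l (2 ^ k * R0) p ?V \<le> G (Suc k) - G k" for k
    unfolding GS unfolding G_def by (rule cmp(3)[OF R0(1)]) simp
  have "G k \<le> G (Suc k)" for k using outG[of k] out0[of "2 ^ k * R0"] by linarith
  moreover have "G k \<le> 2 * E (1/2) 1" for k unfolding G_def by (rule bounded[OF R0(2)])
  ultimately have lim: "(\<lambda>k. G (Suc k) - G k) \<longlonglongrightarrow> 0"
    by (rule increments_tendsto_0)
  obtain K K' where K: "0 < K" "0 < K'" "E K K' < m"
    using exists_balanced_constants[of "1 / (q - 1)" "1 / (p - 1)" m C] pq m(1) unfolding E_def by auto
  have step: "m \<le> K * K' * (G (Suc k) - G k) + E K K'" for k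
  proof -
    have "0 \<le> weighted_mass a l (2 ^ k * R0) p ?V"
      using cmp(2,4)[OF R0(1)[of k], of a] cmp(2)[OF R0(1)[of k], of a l] by (auto intro: order_trans)
    moreover have "K * K' * outer_mass a l (2 ^ k * R0) p ?V \<le> K * K' * (G (Suc k) - G k)"
      using K outG by (intro mult_left_mono) auto
    ultimately show ?thesis using ineq[OF R0(2)[of k] K(1,2)] by linarith
  qed
  have "(\<lambda>k. K * K' * (G (Suc k) - G k) + E K K') \<longlonglongrightarrow> K * K' * 0 + E K K'"
    by (intro tendsto_intros lim)
  then have "m \<le> K * K' * 0 + E K K'"
    by (rule LIMSEQ_le_const) (use step in blast)
  with K(3) show False by simp
qed

text \<open>The radius \<open>R\<close> is chosen with \<open>R powr D = \<beta>/\<epsilon>\<close>, where \<open>\<beta>\<close> is just too large for the inequality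
  \<open>\<epsilon> m \<le> E R powr (-D)\<close> to hold. The cutoff of this radius thus cannot fit into the existence interval.
  A smaller denominator \<open>D'\<close> only weakens the bound, as \<open>\<epsilon> \<le> 1\<close>.\<close>

lemma lifespan_estimate:
  fixes \<sigma> \<delta> :: nat and p q D' :: real
    and u\<^sub>0 u\<^sub>1 v\<^sub>0 v\<^sub>1 :: "'a::euclidean_space \<Rightarrow> real"
  assumes \<sigma>: "0 < \<delta>" "\<delta> < \<sigma>" and pq: "1 < p" "1 < q"
    and L1: "u\<^sub>1 \<in> Lp 1 UNIV" "v\<^sub>1 \<in> Lp 1 UNIV"
    and pos: "positive_mass \<delta> u\<^sub>0 u\<^sub>1" "positive_mass \<delta> v\<^sub>0 v\<^sub>1"
    and D': "0 < D'" "D' \<le> k_minus \<sigma> \<delta> + 2 * \<sigma> * (1 + p) / (p * q - 1) - DIM('a)"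
  shows "\<exists>C>0. \<exists>\<epsilon>\<^sub>0>0. \<forall>\<epsilon> T u v. 0 < \<epsilon> \<and> \<epsilon> \<le> \<epsilon>\<^sub>0 \<and>
    weak_solution \<sigma> \<delta> p q T (\<lambda>x. \<epsilon> * u\<^sub>0 x) (\<lambda>x. \<epsilon> * u\<^sub>1 x) (\<lambda>x. \<epsilon> * v\<^sub>0 x) (\<lambda>x. \<epsilon> * v\<^sub>1 x) u v
    \<longrightarrow> T \<le> ereal (C * \<epsilon> powr (- ((2 * real \<sigma> - k_minus \<sigma> \<delta>) / D')))"
proof -
  define a where "a = 2 * \<sigma> - k_minus \<sigma> \<delta>"
  define D where "D = k_minus \<sigma> \<delta> + 2 * \<sigma> * (1 + p) / (p * q - 1) - DIM('a)"
  have D: "0 < D" "D' \<le> D" using D' by (simp_all add: D_def)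
  have a: "real a = 2 * real \<sigma> - k_minus \<sigma> \<delta>" by (simp add: a_def k_minus_def of_nat_diff)
  obtain l C where l: "0 < l" "0 \<le> C" and est:
    "\<And>T (u\<^sub>0 :: 'a \<Rightarrow> real) u\<^sub>1 v\<^sub>0 v\<^sub>1 u v R K K'.
      1 \<le> R \<Longrightarrow> ereal ((2 * R) ^ a) < T \<Longrightarrow> 0 < K \<Longrightarrow> 0 < K' \<Longrightarrow> u\<^sub>1 \<in> Lp 1 UNIV \<Longrightarrow> v\<^sub>1 \<in> Lp 1 UNIV \<Longrightarrow>
      weak_solution \<sigma> \<delta> p q T u\<^sub>0 u\<^sub>1 v\<^sub>0 v\<^sub>1 u v \<Longrightarrow> 0 \<le> data_pairing \<delta> v\<^sub>0 v\<^sub>1 (dilated_bump l R) \<Longrightarrow>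
      weighted_mass a l R p (\<lambda>(t, x). v t x) + data_pairing \<delta> u\<^sub>0 u\<^sub>1 (dilated_bump l R)
      \<le> K * K' * outer_mass a l R p (\<lambda>(t, x). v t x)
        + C * (K' powr (- 1 / (q - 1)) + K' * K powr (- 1 / (p - 1))) * R powr - D"
    using system_estimate[OF \<sigma> pq, where 'a='a, folded a_def D_def] by blast
  obtain m Ru where m: "0 < m" "1 \<le> Ru" "\<And>R. Ru \<le> R \<Longrightarrow> m \<le> data_pairing \<delta> u\<^sub>0 u\<^sub>1 (dilated_bump l R)"
    using positive_mass_pairing[OF pos(1) L1(1) l(1)] by blast
  obtain mv Rv where mv: "0 < mv" "1 \<le> Rv" "\<And>R. Rv \<le> R \<Longrightarrow> mv \<le> data_pairing \<delta> v\<^sub>0 v\<^sub>1 (dilated_bump l R)"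
    using positive_mass_pairing[OF pos(2) L1(2) l(1)] by blast
  define R0 where "R0 = max Ru Rv"
  have R0: "1 \<le> R0" using m(2) by (simp add: R0_def)
  define E where "E = C * (1 + 1 powr (- 1 / (p - 1)))"
  have E: "0 \<le> E" using l(2) by (simp add: E_def)
  define \<beta> where "\<beta> = E / m + 1"
  have \<beta>: "1 \<le> \<beta>" "E < \<beta> * m" using E m(1) by (simp_all add: \<beta>_def field_simps)
  define A where "A = 2 ^ a * \<beta> powr (a / D)"
  \<comment> \<open>The second bound ensures \<open>R \<ge> R0\<close>, where the data have positive mass.\<close>
  define \<epsilon>\<^sub>0 where "\<epsilon>\<^sub>0 = min 1 (\<beta> / R0 powr D)"
  have "0 < A" "0 < \<epsilon>\<^sub>0" using \<beta> R0 by (simp_all add: A_def \<epsilon>\<^sub>0_def)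
  moreover have "T \<le> ereal (A * \<epsilon> powr (- ((2 * real \<sigma> - k_minus \<sigma> \<delta>) / D')))"
    if \<epsilon>: "0 < \<epsilon>" "\<epsilon> \<le> \<epsilon>\<^sub>0" and
      sol: "weak_solution \<sigma> \<delta> p q T (\<lambda>x. \<epsilon> * u\<^sub>0 x) (\<lambda>x. \<epsilon> * u\<^sub>1 x) (\<lambda>x. \<epsilon> * v\<^sub>0 x) (\<lambda>x. \<epsilon> * v\<^sub>1 x) u v"
    for \<epsilon> T u v
  proof (rule ccontr)
    assume "\<not> ?thesis"
    then have T: "ereal (A * \<epsilon> powr (- ((2 * real \<sigma> - k_minus \<sigma> \<delta>) / D'))) < T" by simp
    have \<epsilon>1: "\<epsilon> \<le> 1" "\<epsilon> \<le> \<beta> / R0 powr D" using \<epsilon>(2) by (simp_all add: \<epsilon>\<^sub>0_def)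
    define R where "R = (\<beta> / \<epsilon>) powr (1 / D)"
    have RD: "R powr D = \<beta> / \<epsilon>" using D \<beta> \<epsilon> by (simp add: R_def powr_powr)
    have "R0 powr D \<le> \<beta> / \<epsilon>" using \<epsilon>1(2) \<epsilon>(1) R0 by (simp add: field_simps)
    then have "(R0 powr D) powr (1 / D) \<le> R" unfolding R_def using D by (intro powr_mono2) auto
    then have R: "R0 \<le> R" using D R0 by (simp add: powr_powr)
    then have R': "1 \<le> R" "Ru \<le> R" "Rv \<le> R" using R0 by (auto simp: R0_def)
    have "(2 * R) ^ a = 2 ^ a * R powr a" using R' by (simp add: power_mult_distrib powr_realpow)
    also have "R powr a = \<beta> powr (a / D) * \<epsilon> powr - (a / D)"
      using \<beta> \<epsilon> by (simp add: R_def powr_powr powr_divide powr_minus_divide)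
    also have "\<epsilon> powr - (a / D) \<le> \<epsilon> powr - (a / D')"
      using \<epsilon>(1) \<epsilon>1(1) D D' by (intro powr_mono') (auto simp: divide_left_mono)
    finally have "(2 * R) ^ a \<le> A * \<epsilon> powr - (a / D')"
      using \<beta> by (simp add: A_def mult_left_mono mult.assoc)
    then have RT: "ereal ((2 * R) ^ a) < T" using T unfolding a by (meson ereal_less_eq(3) le_less_trans)
    have eL1: "(\<lambda>x. \<epsilon> * u\<^sub>1 x) \<in> Lp 1 UNIV" "(\<lambda>x. \<epsilon> * v\<^sub>1 x) \<in> Lp 1 UNIV"
      using L1 by (auto simp: Lp_def abs_mult)
    let ?V = "\<lambda>(t, x). v t x"
    have loc: "?V \<in> local_Lp p (time_interval T \<times> UNIV)"
      using sol by (simp add: weak_solution_def)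
    have "weighted_mass a l R p ?V + \<epsilon> * data_pairing \<delta> u\<^sub>0 u\<^sub>1 (dilated_bump l R)
      \<le> 1 * 1 * outer_mass a l R p ?V + C * (1 powr (- 1 / (q - 1)) + 1 * 1 powr (- 1 / (p - 1))) * R powr - D"
      unfolding data_pairing_scale[symmetric]
      by (rule est[OF R'(1) RT _ _ eL1 sol])
         (use mv(1) mv(3)[OF R'(3)] \<epsilon>(1) in \<open>auto simp: data_pairing_scale\<close>)
    with mass_comparison(1)[OF R'(1) RT loc, of l]
    have "\<epsilon> * data_pairing \<delta> u\<^sub>0 u\<^sub>1 (dilated_bump l R) \<le> E * R powr - D"
      by (simp add: E_def)
    also have "R powr - D = \<epsilon> / \<beta>" using RD by (simp add: powr_minus_divide)
    finally have "\<epsilon> * data_pairing \<delta> u\<^sub>0 u\<^sub>1 (dilated_bump l R) \<le> E * (\<epsilon> / \<beta>)" .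
    moreover have "\<epsilon> * m \<le> \<epsilon> * data_pairing \<delta> u\<^sub>0 u\<^sub>1 (dilated_bump l R)"
      using m(3)[OF R'(2)] \<epsilon> by simp
    ultimately have "\<epsilon> * m \<le> \<epsilon> * (E / \<beta>)" by (simp add: mult.commute)
    then have "m * \<beta> \<le> E" using \<epsilon>(1) \<beta>(1) by (simp add: pos_le_divide_eq)
    then show False using \<beta>(2) by (simp add: mult.commute)
  qed
  ultimately show ?thesis by blast
qed

lemma weak_solution_swap:
  "weak_solution \<sigma> \<delta> p q T u\<^sub>0 u\<^sub>1 v\<^sub>0 v\<^sub>1 u v \<longleftrightarrow> weak_solution \<sigma> \<delta> q p T v\<^sub>0 v\<^sub>1 u\<^sub>0 u\<^sub>1 v u"
  by (auto simp: weak_solution_def)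

text \<open>The left-hand side has \<open>pq\<close> in place of \<open>pq - 1\<close>. The numerator contains \<open>1 + q\<close>, so it is the
  estimate for the mass of \<open>u\<close>, with the roles of the two equations interchanged, that the lifespan bound
  rests on.\<close>

lemma lifespan_denom_le:
  assumes "1 < p" "1 < q"
  shows "lifespan_denom \<sigma> \<delta> p q n \<le> k_minus \<sigma> \<delta> + 2 * \<sigma> * (1 + q) / (p * q - 1) - n"
proof -
  have "p * q - 1 > 0" using assms mult_strict_mono[of 1 p 1 q] by simp
  then have "2 * \<sigma> * (1 + q) / (p * q) \<le> 2 * \<sigma> * (1 + q) / (p * q - 1)"
    using assms by (intro divide_left_mono) auto
  then show ?thesis by (simp add: lifespan_denom_def add.commute)
qed

theorem theorem4p1:
  fixes \<sigma> \<delta> :: nat and p q :: real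
    and u\<^sub>0 u\<^sub>1 v\<^sub>0 v\<^sub>1 :: "real ^ 'n \<Rightarrow> real"
  assumes "0 < \<delta>" "\<delta> < \<sigma>" "p > 1" "q > 1"
    and "(u\<^sub>0, u\<^sub>1) \<in> data_space (k_plus \<sigma> \<delta>)"
    and "(v\<^sub>0, v\<^sub>1) \<in> data_space (k_plus \<sigma> \<delta>)"
    and "positive_mass \<delta> u\<^sub>0 u\<^sub>1"
    and "positive_mass \<delta> v\<^sub>0 v\<^sub>1"
    and "real CARD('n) \<le> k_minus \<sigma> \<delta> + 2 * \<sigma> * (1 + max p q) / (p * q - 1)"
  shows "(\<nexists>u v. energy_solution \<sigma> \<delta> p q \<infinity> u\<^sub>0 u\<^sub>1 v\<^sub>0 v\<^sub>1 u v) \<and>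
    (lifespan_denom \<sigma> \<delta> p q CARD('n) > 0 \<longrightarrow>
      (\<exists>C>0. \<exists>\<epsilon>\<^sub>0>0. \<forall>\<epsilon>. 0 < \<epsilon> \<and> \<epsilon> \<le> \<epsilon>\<^sub>0 \<longrightarrow>
        blow_up_time \<sigma> \<delta> p q (\<lambda>x. \<epsilon> * u\<^sub>0 x) (\<lambda>x. \<epsilon> * u\<^sub>1 x) (\<lambda>x. \<epsilon> * v\<^sub>0 x) (\<lambda>x. \<epsilon> * v\<^sub>1 x)
          \<le> ereal (C * \<epsilon> powr (- ((2 * real \<sigma> - k_minus \<sigma> \<delta>) / lifespan_denom \<sigma> \<delta> p q CARD('n))))))"
proof (intro conjI impI)
  have L1: "u\<^sub>1 \<in> Lp 1 UNIV" "v\<^sub>1 \<in> Lp 1 UNIV"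
    using assms(5,6) by (simp_all add: data_space_def)
  have dim: "DIM(real ^ 'n) = CARD('n)" by simp
  show "\<nexists>u v. energy_solution \<sigma> \<delta> p q \<infinity> u\<^sub>0 u\<^sub>1 v\<^sub>0 v\<^sub>1 u v"
  proof (cases "q \<le> p")
    case True
    then have "\<not> weak_solution \<sigma> \<delta> p q \<infinity> u\<^sub>0 u\<^sub>1 v\<^sub>0 v\<^sub>1 u v" for u v
      by (intro no_global_weak_solution[OF assms(1-4) L1 assms(7,8)]) (use assms(9) in simp)
    then show ?thesis by (auto simp: energy_solution_def)
  next
    case False
    then have "\<not> weak_solution \<sigma> \<delta> q p \<infinity> v\<^sub>0 v\<^sub>1 u\<^sub>0 u\<^sub>1 v u" for u v
      by (intro no_global_weak_solution[OF assms(1,2,4,3) L1(2,1) assms(8,7)])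
         (use assms(9) in \<open>simp add: mult.commute[of q p]\<close>)
    then show ?thesis by (auto simp: energy_solution_def weak_solution_swap[of \<sigma> \<delta> p])
  qed
  let ?d = "lifespan_denom \<sigma> \<delta> p q CARD('n)"
  assume d: "?d > 0"
  have "?d \<le> k_minus \<sigma> \<delta> + 2 * \<sigma> * (1 + q) / (q * p - 1) - DIM(real ^ 'n)"
    unfolding dim using lifespan_denom_le[OF assms(3,4), of \<sigma> \<delta> "CARD('n)"] by (simp add: mult.commute[of q p])
  from lifespan_estimate[OF assms(1,2,4,3) L1(2,1) assms(8,7) d this]
  obtain C \<epsilon>\<^sub>0 where C: "0 < C" "0 < \<epsilon>\<^sub>0" and bound: "\<And>\<epsilon> T u v. 0 < \<epsilon> \<Longrightarrow> \<epsilon> \<le> \<epsilon>\<^sub>0 \<Longrightarrow>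
    weak_solution \<sigma> \<delta> q p T (\<lambda>x. \<epsilon> * v\<^sub>0 x) (\<lambda>x. \<epsilon> * v\<^sub>1 x) (\<lambda>x. \<epsilon> * u\<^sub>0 x) (\<lambda>x. \<epsilon> * u\<^sub>1 x) v u
    \<Longrightarrow> T \<le> ereal (C * \<epsilon> powr (- ((2 * real \<sigma> - k_minus \<sigma> \<delta>) / ?d)))"
    by blast
  have "blow_up_time \<sigma> \<delta> p q (\<lambda>x. \<epsilon> * u\<^sub>0 x) (\<lambda>x. \<epsilon> * u\<^sub>1 x) (\<lambda>x. \<epsilon> * v\<^sub>0 x) (\<lambda>x. \<epsilon> * v\<^sub>1 x)
      \<le> ereal (C * \<epsilon> powr (- ((2 * real \<sigma> - k_minus \<sigma> \<delta>) / ?d)))" if "0 < \<epsilon> \<and> \<epsilon> \<le> \<epsilon>\<^sub>0" for \<epsilon>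
    unfolding blow_up_time_def
  proof (rule Sup_least)
    fix T
    assume "T \<in> {T. 0 < T \<and> (\<exists>u v. energy_solution \<sigma> \<delta> p q T (\<lambda>x. \<epsilon> * u\<^sub>0 x) (\<lambda>x. \<epsilon> * u\<^sub>1 x)
      (\<lambda>x. \<epsilon> * v\<^sub>0 x) (\<lambda>x. \<epsilon> * v\<^sub>1 x) u v)}"
    then obtain u v where "weak_solution \<sigma> \<delta> q p T (\<lambda>x. \<epsilon> * v\<^sub>0 x) (\<lambda>x. \<epsilon> * v\<^sub>1 x) (\<lambda>x. \<epsilon> * u\<^sub>0 x) (\<lambda>x. \<epsilon> * u\<^sub>1 x) v u"
      by (auto simp: energy_solution_def weak_solution_swap[of \<sigma> \<delta> p])
    with that show "T \<le> ereal (C * \<epsilon> powr (- ((2 * real \<sigma> - k_minus \<sigma> \<delta>) / ?d)))"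
      using bound by blast
  qed
  with C show "\<exists>C>0. \<exists>\<epsilon>\<^sub>0>0. \<forall>\<epsilon>. 0 < \<epsilon> \<and> \<epsilon> \<le> \<epsilon>\<^sub>0 \<longrightarrow>
        blow_up_time \<sigma> \<delta> p q (\<lambda>x. \<epsilon> * u\<^sub>0 x) (\<lambda>x. \<epsilon> * u\<^sub>1 x) (\<lambda>x. \<epsilon> * v\<^sub>0 x) (\<lambda>x. \<epsilon> * v\<^sub>1 x)
          \<le> ereal (C * \<epsilon> powr (- ((2 * real \<sigma> - k_minus \<sigma> \<delta>) / ?d)))"
    by blast
qed

end
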